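(* Let $p>2$, assume $(a_* )$ and $(a_+)$, and let $u\in K_a$ be a maximizer of $$\max_{v\in K_a}\mathcal J(v). \tag{P}$$ Then there exists $\mu\in\mathbb R$ such that for every connected open set $U\subset\Omega$ with $$\|\nabla u\|_{L^\infty(U)}<1\qquad\text{and}\qquad a(x)\ne0\ \text{ for a.e. }x\in U,$$ the function $u$ is constant in $U$; more precisely, $$u\equiv0\qquad\text{or}\qquad u\equiv\frac{p-1}{p}\mu\quad\text{in }U,$$ with $\mu$ independent of $U$. Moreover, whenever $u\not\equiv0$ in $U$, the constant $\mu$ is characterized by $$D\mathcal J(u)[\varphi]=\mu\,D\mathcal C(u)[\varphi]\qquad\text{for every }\varphi\in C_c^\infty(U).$$
   Context: $\Omega\subset\mathbb R^N$ is a bounded convex domain, $N\ge2$, with $\partial\Omega\in C^2$; $a:\Omega\to\mathbb R$. Hypotheses: $(a_* )$: $a\in L^\infty(\Omega)$ and $\int_\Omega a(x)\,dx<0$; $(a_+)$: the set $\{x\in\Omega:a(x)>0\}$ has nonempty interior. For $u\in W^{1,\infty}(\Omega)$, $$\mathcal J(u):=\int_\Omega a(x)|u|^p\,dx,\qquad \mathcal C(u):=\int_\Omega a(x)|u|^{p-2}u\,dx,$$ and $D\mathcal J(u)$, $D\mathcal C(u)$ denote their Fréchet derivatives on $W^{1,\infty}(\Omega)$. The admissible set is $$K_a:=\{u\in W^{1,\infty}(\Omega):\|\nabla u\|_{L^\infty(\Omega)}\le1,\ \mathcal C(u)=0\}.$$ Functions in $W^{1,\infty}(\Omega)$ are identified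 with their continuous representatives. *)

theory Defs
  imports "HOL-Analysis.Analysis" "HOL-Probability.Essential_Supremum"
begin

text \<open>
  Functions on a domain \<open>\<Omega>\<close> are total functions; their values outside \<open>\<Omega>\<close> are irrelevant.
\<close>

section \<open>Smooth functions and the boundary regularity\<close>

primrec Ck_on :: "nat \<Rightarrow> 'a::euclidean_space set \<Rightarrow> ('a \<Rightarrow> real) \<Rightarrow> bool" where
  "Ck_on 0 S f \<longleftrightarrow> continuous_on S f"
| "Ck_on (Suc k) S f \<longleftrightarrow> (\<forall>x\<in>S. f differentiable (at x)) \<and>
     (\<forall>i\<in>Basis. Ck_on k S (\<lambda>x. frechet_derivative f (at x) i))"

text \<open>
  Elements of \<open>C\<^sub>c\<^sup>\<infinity>(U)\<close> are represented by their extension by zero to the whole space.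
\<close>

definition Cc_inf :: "'a::euclidean_space set \<Rightarrow> ('a \<Rightarrow> real) set" where
  "Cc_inf U = {\<phi>. (\<forall>k. Ck_on k UNIV \<phi>) \<and>
     compact (closure (support_on UNIV \<phi>)) \<and> closure (support_on UNIV \<phi>) \<subseteq> U}"

text \<open>
  Near each boundary point, in suitable orthonormal coordinates with last axis \<open>\<nu>\<close>, the set
  is the part above the graph of a \<open>C\<^sup>2\<close> function \<open>\<gamma>\<close> of the remaining coordinates.  The
  function \<open>\<gamma>\<close> is defined on the whole space, but only evaluated on the hyperplane
  orthogonal to \<open>\<nu>\<close>.
\<close>

definition C2_boundary :: "'a::euclidean_space set \<Rightarrow> bool" where
  "C2_boundary \<Omega> \<longleftrightarrow> (\<forall>z\<in>frontier \<Omega>. \<exists>r>0. \<exists>\<nu> \<gamma>. norm \<nu> = 1 \<and> Ck_on 2 UNIV \<gamma> \<and>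
     \<Omega> \<inter> ball z r = {x \<in> ball z r. \<gamma> (x - (x \<bullet> \<nu>) *\<^sub>R \<nu>) < x \<bullet> \<nu>})"

section \<open>Lebesgue and Sobolev spaces\<close>

definition Linf_norm :: "'a::euclidean_space set \<Rightarrow> ('a \<Rightarrow> 'b::euclidean_space) \<Rightarrow> ennreal" where
  "Linf_norm S f = esssup (lebesgue_on S) (\<lambda>x. ennreal (norm (f x)))"

definition Linf :: "'a::euclidean_space set \<Rightarrow> ('a \<Rightarrow> 'b::euclidean_space) set" where
  "Linf S = {f. f \<in> borel_measurable (lebesgue_on S) \<and> Linf_norm S f < \<infinity>}"

definition locally_integrable :: "'a::euclidean_space set \<Rightarrow> ('a \<Rightarrow> 'b::euclidean_space) \<Rightarrow> bool" where
  "locally_integrable \<Omega> f \<longleftrightarrow> (\<forall>K. compact K \<and> K \<subseteq> \<Omega> \<longrightarrow> integrable (lebesgue_on K) f)"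

definition has_weak_gradient ::
  "'a::euclidean_space set \<Rightarrow> ('a \<Rightarrow> real) \<Rightarrow> ('a \<Rightarrow> 'a) \<Rightarrow> bool" where
  "has_weak_gradient \<Omega> u g \<longleftrightarrow> locally_integrable \<Omega> u \<and> locally_integrable \<Omega> g \<and>
     (\<forall>\<phi>\<in>Cc_inf \<Omega>. \<forall>i\<in>Basis.
        (LINT x|lebesgue_on \<Omega>. u x * frechet_derivative \<phi> (at x) i) =
        - (LINT x|lebesgue_on \<Omega>. (g x \<bullet> i) * \<phi> x))"

text \<open>
  On an open set the weak gradient is unique up to null sets, so the choice does not affect
  the norms below.
\<close>

definition weak_grad :: "'a::euclidean_space set \<Rightarrow> ('a \<Rightarrow> real) \<Rightarrow> 'a \<Rightarrow> 'a" where
  "weak_grad \<Omega> u = (SOME g. has_weak_gradient \<Omega> u g)"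

text \<open>Elements of \<open>W\<^sup>1\<^sup>,\<^sup>\<infinity>(\<Omega>)\<close> are represented by their continuous representatives.\<close>

definition W1inf :: "'a::euclidean_space set \<Rightarrow> ('a \<Rightarrow> real) set" where
  "W1inf \<Omega> = {u. continuous_on \<Omega> u \<and> u \<in> Linf \<Omega> \<and> (\<exists>g\<in>Linf \<Omega>. has_weak_gradient \<Omega> u g)}"

definition W1inf_norm :: "'a::euclidean_space set \<Rightarrow> ('a \<Rightarrow> real) \<Rightarrow> real" where
  "W1inf_norm \<Omega> u = enn2real (Linf_norm \<Omega> u) + enn2real (Linf_norm \<Omega> (weak_grad \<Omega> u))"

section \<open>Frechet derivatives on the Sobolev space\<close>

text \<open>
  The space depends on \<open>\<Omega>\<close> and hence is not a type, so the library's derivative on normed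
  spaces does not apply.  The definition below is its analogue, including the choice operator
  of \<open>frechet_derivative\<close>: the derivative is unique as a functional on \<open>W1inf \<Omega>\<close>, and
  it is only meaningful there.
\<close>

definition has_W1inf_derivative ::
  "'a::euclidean_space set \<Rightarrow> (('a \<Rightarrow> real) \<Rightarrow> real) \<Rightarrow> (('a \<Rightarrow> real) \<Rightarrow> real) \<Rightarrow> ('a \<Rightarrow> real) \<Rightarrow> bool"
where
  "has_W1inf_derivative \<Omega> F L u \<longleftrightarrow>
     (\<forall>v\<in>W1inf \<Omega>. \<forall>w\<in>W1inf \<Omega>. L (\<lambda>x. v x + w x) = L v + L w) \<and>
     (\<forall>c. \<forall>v\<in>W1inf \<Omega>. L (\<lambda>x. c * v x) = c * L v) \<and>
     (\<exists>B. \<forall>v\<in>W1inf \<Omega>. \<bar>L v\<bar> \<le> B * W1inf_norm \<Omega> v) \<and>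
     (\<forall>\<epsilon>>0. \<exists>\<delta>>0. \<forall>h\<in>W1inf \<Omega>. W1inf_norm \<Omega> h < \<delta> \<longrightarrow>
        \<bar>F (\<lambda>x. u x + h x) - F u - L h\<bar> \<le> \<epsilon> * W1inf_norm \<Omega> h)"

definition W1inf_derivative ::
  "'a::euclidean_space set \<Rightarrow> (('a \<Rightarrow> real) \<Rightarrow> real) \<Rightarrow> ('a \<Rightarrow> real) \<Rightarrow> ('a \<Rightarrow> real) \<Rightarrow> real"
where
  "W1inf_derivative \<Omega> F u = (SOME L. has_W1inf_derivative \<Omega> F L u)"

section \<open>The functionals and the admissible set\<close>

definition J_fun ::
  "'a::euclidean_space set \<Rightarrow> ('a \<Rightarrow> real) \<Rightarrow> real \<Rightarrow> ('a \<Rightarrow> real) \<Rightarrow> real" where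
  "J_fun \<Omega> a p u = (LINT x|lebesgue_on \<Omega>. a x * \<bar>u x\<bar> powr p)"

definition C_fun ::
  "'a::euclidean_space set \<Rightarrow> ('a \<Rightarrow> real) \<Rightarrow> real \<Rightarrow> ('a \<Rightarrow> real) \<Rightarrow> real" where
  "C_fun \<Omega> a p u = (LINT x|lebesgue_on \<Omega>. a x * \<bar>u x\<bar> powr (p - 2) * u x)"

definition K_set ::
  "'a::euclidean_space set \<Rightarrow> ('a \<Rightarrow> real) \<Rightarrow> real \<Rightarrow> ('a \<Rightarrow> real) set" where
  "K_set \<Omega> a p = {u \<in> W1inf \<Omega>. Linf_norm \<Omega> (weak_grad \<Omega> u) \<le> 1 \<and> C_fun \<Omega> a p u = 0}"

end

theory Submission
  imports Defs
begin

text \<open>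
  The result is a Lagrange multiplier rule combined with the fact that the Euler equation
  contains no derivatives of \<open>u\<close>.  Where the gradient of the maximizer \<open>u\<close> is bounded
  by a constant below 1, a small multiple of any test function may be added to \<open>u\<close> without
  violating the gradient constraint (\<open>gradient_bound_stable_under_test_functions\<close>), so only the
  scalar constraint \<open>C_fun = 0\<close> is active.  Two-parameter variations
  \<open>u + t \<phi> + s \<psi>\<close> and the elementary multiplier rule
  \<open>constrained_max_derivative_eq_0\<close> then yield
  \<open>DJ \<phi> * DC \<psi> = DJ \<psi> * DC \<phi>\<close> for the derivatives \<open>DJ\<close> and \<open>DC\<close> of the two functionals
  at \<open>u\<close> (\<open>derivatives_proportional_where_gradient_slack\<close>).

  Let \<open>U\<close> be a region as in the theorem on which \<open>u\<close> is not identically zero.  Some test function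
  \<open>\<psi>\<close> in \<open>U\<close> has \<open>DC \<psi> \<noteq> 0\<close>, since otherwise
  \<open>a \<bar>u\<bar>\<^sup>p\<^sup>-\<^sup>2\<close> would vanish in \<open>U\<close>.  Hence \<open>DJ = \<mu> DC\<close> on the test
  functions in \<open>U\<close> for the single number \<open>\<mu> = DJ \<psi> / DC \<psi>\<close>.  The proportionality also holds on
  the union of two such regions, which forces their multipliers to be equal.

  Since \<open>DJ\<close> and \<open>DC\<close> are integrals against \<open>p a \<bar>u\<bar>\<^sup>p\<^sup>-\<^sup>2 u\<close> and
  \<open>(p - 1) a \<bar>u\<bar>\<^sup>p\<^sup>-\<^sup>2\<close>, the relation \<open>DJ = \<mu> DC\<close> is the pointwise equation
  \<open>a \<bar>u\<bar>\<^sup>p\<^sup>-\<^sup>2 (p u - (p - 1) \<mu>) = 0\<close> (\<open>pointwise_equation_if_weak_equation\<close>).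
  With \<open>a \<noteq> 0\<close> it leaves only the values \<open>0\<close> and \<open>(p - 1) / p * \<mu>\<close>, and a continuous
  function on a connected set cannot take both.

  Two representation facts support the argument.  Derivatives and weak gradients are given by
  choice operators, and are identified with explicit expressions through uniqueness
  (\<open>W1inf_derivative_unique\<close>, \<open>has_weak_gradient_unique\<close>).  The latter, like the pointwise
  equation, rests on \<open>fundamental_lemma_calculus_of_variations\<close>, which is derived from
  smooth bump functions on boxes and Lebesgue's differentiation theorem.  That
  test functions have their classical gradient as weak gradient is integration by parts,
  obtained from translation invariance of Lebesgue measure.
\<close>

section \<open>Smooth bump functions\<close>

text \<open>
  Being \<open>C\<^sup>k\<close> is defined by recursion on derivatives, so an order of smoothness has to be
  given up explicitly; the product rule needs this, as it multiplies derivatives by the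
  undifferentiated factors.
\<close>

lemma Ck_on_Suc_imp: "Ck_on (Suc k) S f \<Longrightarrow> Ck_on k S f"
proof (induction k arbitrary: f)
  case 0
  then show ?case
    by (simp add: continuous_at_imp_continuous_on differentiable_imp_continuous_within)
next
  case (Suc k)
  then show ?case by simp
qed

lemma Ck_on_const: "Ck_on k UNIV (\<lambda>x. c)"
  by (induction k arbitrary: c) auto

lemma Ck_on_add: "Ck_on k UNIV f \<Longrightarrow> Ck_on k UNIV g \<Longrightarrow> Ck_on k UNIV (\<lambda>x. f x + g x)"
proof (induction k arbitrary: f g)
  case 0
  then show ?case by (auto intro: continuous_intros)
next
  case (Suc k)
  have "frechet_derivative (\<lambda>x. f x + g x) (at x) = (\<lambda>i. frechet_derivative f (at x) i + frechet_derivative g (at x) i)" for x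
    using Suc.prems by (intro frechet_derivative_at[symmetric] has_derivative_add)
      (auto simp: frechet_derivative_works)
  with Suc show ?case by auto
qed

lemma Ck_on_mult: "Ck_on k UNIV f \<Longrightarrow> Ck_on k UNIV g \<Longrightarrow> Ck_on k UNIV (\<lambda>x. f x * g x)"
proof (induction k arbitrary: f g)
  case 0
  then show ?case by (auto intro: continuous_intros)
next
  case (Suc k)
  have "frechet_derivative (\<lambda>x. f x * g x) (at x)
      = (\<lambda>i. f x * frechet_derivative g (at x) i + frechet_derivative f (at x) i * g x)" for x
    using Suc.prems by (intro frechet_derivative_at[symmetric] has_derivative_mult)
      (auto simp: frechet_derivative_works)
  moreover have "Ck_on k UNIV f" "Ck_on k UNIV g"
    using Suc.prems Ck_on_Suc_imp by blast+
  ultimately show ?case using Suc by (auto intro!: Ck_on_add)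
qed

lemma Ck_on_prod: "finite I \<Longrightarrow> (\<And>i. i \<in> I \<Longrightarrow> Ck_on k UNIV (f i)) \<Longrightarrow> Ck_on k UNIV (\<lambda>x. \<Prod>i\<in>I. f i x)"
  by (induction I rule: finite_induct) (auto intro: Ck_on_const Ck_on_mult)

text \<open>
  For \<open>n = 0\<close> this is the standard smooth function that vanishes on the negative half-line.
  The factor \<open>1 / t ^ n\<close> makes the family closed under differentiation up to linear
  combinations, so that smoothness of all its members follows by one induction.
\<close>

definition flat :: "nat \<Rightarrow> real \<Rightarrow> real" where
  "flat n t = (if t > 0 then exp (- 1 / t) / t ^ n else 0)"

text \<open>
  At the origin, \<open>flat n h / h\<close> is \<open>y ^ (n + 1) / exp y\<close> with \<open>y = 1 / h\<close> for positive \<open>h\<close>.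
\<close>

lemma flat_DERIV: "(flat n has_real_derivative flat (n + 2) t - real n * flat (n + 1) t) (at t)"
proof (cases t "0::real" rule: linorder_cases)
  case less
  have "((\<lambda>_. 0) has_real_derivative 0) (at t)" by simp
  then have "(flat n has_real_derivative 0) (at t)"
    by (rule has_field_derivative_transform_within_open[of _ _ _ "{..<0}"]) (use less in \<open>auto simp: flat_def\<close>)
  then show ?thesis using less by (simp add: flat_def)
next
  case greater
  have eq: "exp (- 1 / t) * (1 / t\<^sup>2) / t ^ n - exp (- 1 / t) * (real n * t ^ (n - 1)) / (t ^ n)\<^sup>2
      = flat (n + 2) t - real n * flat (n + 1) t"
    using greater by (cases n) (auto simp: flat_def field_simps power2_eq_square)
  have "((\<lambda>t. exp (- 1 / t) / t ^ n) has_real_derivative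
      exp (- 1 / t) * (1 / t\<^sup>2) / t ^ n - exp (- 1 / t) * (real n * t ^ (n - 1)) / (t ^ n)\<^sup>2) (at t)"
    using greater by (auto intro!: derivative_eq_intros simp: field_simps power2_eq_square)
  then have "(flat n has_real_derivative flat (n + 2) t - real n * flat (n + 1) t) (at t)"
    unfolding eq
    by (rule has_field_derivative_transform_within_open[of _ _ _ "{0<..}"]) (use greater in \<open>auto simp: flat_def\<close>)
  then show ?thesis .
next
  case equal
  have "((\<lambda>h. flat n h / h) \<longlongrightarrow> 0) (at 0)"
  proof -
    have "((\<lambda>h::real. (inverse h) ^ (n + 1) / exp (inverse h)) \<longlongrightarrow> 0) (at_right 0)"
      using tendsto_power_div_exp_0 filterlim_inverse_at_top_right by (rule filterlim_compose)
    then have "((\<lambda>h. flat n h / h) \<longlongrightarrow> 0) (at_right 0)"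
      by (rule Lim_transform_eventually)
        (auto simp: eventually_at_right_less flat_def exp_minus field_simps inverse_eq_divide
           intro!: eventually_mono[OF eventually_at_right_less])
    moreover have "((\<lambda>h. flat n h / h) \<longlongrightarrow> 0) (at_left 0)"
      by (rule Lim_transform_eventually[OF tendsto_const])
         (auto simp: flat_def intro!: eventually_mono[OF eventually_at_left_real[of "-1" 0]])
    ultimately show ?thesis by (simp add: filterlim_at_split)
  qed
  then show ?thesis using equal by (simp add: DERIV_def) (simp add: flat_def)
qed

text \<open>
  The statement is for all \<open>n\<close> at once because the derivative of \<open>flat n\<close> involves
  \<open>flat (n + 1)\<close> and \<open>flat (n + 2)\<close>.
\<close>

lemma flat_affine_Ck: "Ck_on k UNIV (\<lambda>x::'a::euclidean_space. flat n (c * (x \<bullet> i) + d))"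
proof (induction k arbitrary: n)
  have D: "((\<lambda>x. flat n (c * (x \<bullet> i) + d)) has_derivative
     (\<lambda>h. (flat (n + 2) (c * (x \<bullet> i) + d) + (- real n) * flat (n + 1) (c * (x \<bullet> i) + d)) * (c * (h \<bullet> i)))) (at x)" for n x
  proof -
    have "((\<lambda>x. c * (x \<bullet> i) + d) has_derivative (\<lambda>h. c * (h \<bullet> i))) (at x)"
      by (auto intro!: derivative_eq_intros)
    from DERIV_compose_FDERIV[OF flat_DERIV this] show ?thesis
      by (simp add: mult.commute)
  qed
  {
    case 0
    show ?case using D[of n] by (auto simp: continuous_on_eq_continuous_within
        intro!: continuous_at_imp_continuous_at_within has_derivative_continuous)
  next
    case (Suc k)
    have "frechet_derivative (\<lambda>x. flat n (c * (x \<bullet> i) + d)) (at x) =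
      (\<lambda>h. (flat (n + 2) (c * (x \<bullet> i) + d) + (- real n) * flat (n + 1) (c * (x \<bullet> i) + d)) * (c * (h \<bullet> i)))" for x
      using D by (rule frechet_derivative_at[symmetric])
    moreover have "(\<lambda>x. flat n (c * (x \<bullet> i) + d)) differentiable at x" for x
      using D by (auto simp: differentiable_def)
    ultimately show ?case
      by (simp only: Ck_on.simps) (intro conjI ballI Ck_on_mult Ck_on_add Ck_on_const Suc TrueI)
  }
qed

text \<open>
  Scaling the argument by \<open>m\<close> pushes \<open>flat 0\<close> up to the indicator of the open
  half-line, and a box is the intersection of two half-spaces per coordinate.
\<close>

definition bump :: "'a::euclidean_space \<Rightarrow> 'a \<Rightarrow> nat \<Rightarrow> 'a \<Rightarrow> real" where
  "bump a b m x = (\<Prod>i\<in>Basis. flat 0 (real m * (x \<bullet> i) + - real m * (a \<bullet> i)) * flat 0 (- real m * (x \<bullet> i) + real m * (b \<bullet> i)))"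

lemma bump_Ck: "Ck_on k UNIV (bump a b m)"
  unfolding bump_def by (intro Ck_on_prod Ck_on_mult flat_affine_Ck) auto

lemma bump_eq_0: "x \<notin> box a b \<Longrightarrow> bump a b m x = 0"
  unfolding bump_def mem_box
  by (auto simp: flat_def algebra_simps mult_less_cancel_left intro!: prod_zero)
   
lemma bump_bounds: "0 \<le> bump a b m x" "bump a b m x \<le> 1"
proof -
  have "0 \<le> flat 0 t" "flat 0 t \<le> 1" for t by (auto simp: flat_def)
  then show "0 \<le> bump a b m x" "bump a b m x \<le> 1"
    unfolding bump_def by (auto intro!: prod_nonneg prod_le_1 mult_le_one)
qed

lemma bump_tendsto: "(\<lambda>m. bump a b m x) \<longlonglongrightarrow> indicator (box a b) x"
proof (cases "x \<in> box a b")
  case False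
  then show ?thesis by (simp add: bump_eq_0)
next
  case True
  have lim: "(\<lambda>m. flat 0 (real m * t)) \<longlonglongrightarrow> 1" if "t > 0" for t
  proof -
    have "(\<lambda>m. exp (- inverse t * inverse (real m))) \<longlonglongrightarrow> exp (- inverse t * 0)"
      by (intro tendsto_intros LIMSEQ_inverse_real_of_nat lim_inverse_n)
    then have "(\<lambda>m. exp (- inverse t * inverse (real m))) \<longlonglongrightarrow> 1" by simp
    then show ?thesis
      by (rule Lim_transform_eventually)
         (use that in \<open>auto simp: flat_def divide_inverse intro!: eventually_mono[OF eventually_gt_at_top[of 0]]\<close>)
  qed
  have "(\<lambda>m. bump a b m x) \<longlonglongrightarrow> (\<Prod>i\<in>(Basis::'a set). 1 * 1)"
    unfolding bump_def
  proof (intro tendsto_prod tendsto_mult)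
    fix i :: 'a assume "i \<in> Basis"
    then show "(\<lambda>m. flat 0 (real m * (x \<bullet> i) + - real m * (a \<bullet> i))) \<longlonglongrightarrow> 1"
       and "(\<lambda>m. flat 0 (- real m * (x \<bullet> i) + real m * (b \<bullet> i))) \<longlonglongrightarrow> 1"
      using True lim[of "x \<bullet> i - a \<bullet> i"] lim[of "b \<bullet> i - x \<bullet> i"] by (auto simp: mem_box algebra_simps)
  qed
  then show ?thesis using True by simp
qed

lemma bump_Cc_inf: assumes "cbox a b \<subseteq> U" shows "bump a b m \<in> Cc_inf U"
proof -
  have "support_on UNIV (bump a b m) \<subseteq> box a b"
    using bump_eq_0 by (force simp: support_on_def)
  then have "closure (support_on UNIV (bump a b m)) \<subseteq> cbox a b"
    by (metis box_subset_cbox closed_cbox closure_minimal subset_trans)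
  then show ?thesis
    using assms bump_Ck by (auto simp: Cc_inf_def intro: compact_cbox compact_closure bounded_subset[OF bounded_cbox] closure_subset dest: order_trans[OF closure_subset])
qed

section \<open>The fundamental lemma and the divergence theorem\<close>

lemma AE_lebesgue_on_iff_negligible:
  assumes "S \<in> sets lebesgue"
  shows "(AE x in lebesgue_on S. P x) \<longleftrightarrow> negligible {x \<in> S. \<not> P x}"
proof
  assume "AE x in lebesgue_on S. P x"
  then obtain N where "N \<in> null_sets (lebesgue_on S)" "{x \<in> S. \<not> P x} \<subseteq> N"
    by (auto simp: eventually_ae_filter)
  then show "negligible {x \<in> S. \<not> P x}"
    using assms negligible_subset by (auto simp: null_sets_restrict_space negligible_iff_null_sets[symmetric])
next
  assume "negligible {x \<in> S. \<not> P x}"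
  then have "{x \<in> S. \<not> P x} \<in> null_sets (lebesgue_on S)"
    using assms by (auto simp: null_sets_restrict_space negligible_iff_null_sets[symmetric])
  then show "AE x in lebesgue_on S. P x"
    by (rule AE_I') auto
qed

text \<open>
  Dominated convergence along the bumps replaces the test function by the indicator of the box.
\<close>

lemma box_integral_eq_0_if_orthogonal_to_bumps:
  fixes f :: "'a::euclidean_space \<Rightarrow> real"
  assumes U: "open U" and f: "locally_integrable U f"
    and orth: "\<And>\<phi>. \<phi> \<in> Cc_inf U \<Longrightarrow> (LINT x|lebesgue_on U. f x * \<phi> x) = 0"
    and sub: "cbox a b \<subseteq> U"
  shows "integral (cbox a b) f = 0"
proof -
  let ?M = "lebesgue_on (cbox a b)"
  have int: "integrable ?M f"
    using f sub by (auto simp: locally_integrable_def)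
  have meas_bump: "bump a b m \<in> borel_measurable borel" for m
    using bump_Ck[of 0 a b m] by (auto intro: borel_measurable_continuous_onI)
  have meas_bump': "bump a b m \<in> borel_measurable ?M" for m
    using meas_bump by (intro measurable_restrict_space1 measurable_completion) auto
  have zero: "(LINT x|?M. f x * bump a b m x) = 0" for m
  proof -
    have "(LINT x|lebesgue_on U. f x * bump a b m x) = (LINT x|lebesgue_on U. (if x \<in> cbox a b then f x * bump a b m x else 0))"
      using bump_eq_0 subsetD[OF box_subset_cbox] by (intro Bochner_Integration.integral_cong) fastforce+
    also have "\<dots> = (LINT x|?M. f x * bump a b m x)"
      using U sub by (intro integral_restrict) auto
    finally show ?thesis
      using orth[OF bump_Cc_inf[OF sub]] by simp
  qed
  have meas_box: "(\<lambda>x. f x * indicator (box a b) x) \<in> borel_measurable ?M"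
    using int by (intro borel_measurable_times borel_measurable_indicator) (auto simp: sets_restrict_space_iff intro: subsetD[OF box_subset_cbox])
  have "(\<lambda>m. LINT x|?M. f x * bump a b m x) \<longlonglongrightarrow> (LINT x|?M. f x * indicator (box a b) x)"
  proof (rule integral_dominated_convergence)
    show "integrable ?M (\<lambda>x. \<bar>f x\<bar>)" using int by simp
    show "AE x in ?M. (\<lambda>m. f x * bump a b m x) \<longlonglongrightarrow> f x * indicator (box a b) x"
      by (intro AE_I2 tendsto_intros bump_tendsto)
    show "AE x in ?M. norm (f x * bump a b m x) \<le> \<bar>f x\<bar>" for m
      using bump_bounds[of a b m] by (intro AE_I2) (auto simp: abs_mult intro!: mult_left_le)
    show "(\<lambda>x. f x * bump a b m x) \<in> borel_measurable ?M" for m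
      using int meas_bump' by (auto intro: borel_measurable_times)
  qed (fact meas_box)
  with zero have "(LINT x|?M. f x * indicator (box a b) x) = 0"
    by (simp add: LIMSEQ_const_iff)
  moreover have "AE x in ?M. f x * indicator (box a b) x = f x"
    using negligible_frontier_interval[of a b]
    by (subst AE_lebesgue_on_iff_negligible) (auto simp: indicator_def elim!: negligible_subset)
  then have "(LINT x|?M. f x * indicator (box a b) x) = (LINT x|?M. f x)"
    using meas_box int by (intro integral_cong_AE) auto
  ultimately show ?thesis
    using int by (simp add: lebesgue_integral_eq_integral)
qed

text \<open>
  The integrals of \<open>f\<close> over all boxes in \<open>U\<close> vanish, and by Lebesgue's differentiation
  theorem \<open>f\<close> is almost everywhere the limit of its averages over shrinking cubes.  As \<open>f\<close> is only
  locally integrable, the differentiation theorem is applied to its truncations to countably many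
  boxes that cover \<open>U\<close>.
\<close>

lemma fundamental_lemma_calculus_of_variations:
  fixes f :: "'a::euclidean_space \<Rightarrow> real"
  assumes U: "open U" and f: "locally_integrable U f"
    and orth: "\<And>\<phi>. \<phi> \<in> Cc_inf U \<Longrightarrow> (LINT x|lebesgue_on U. f x * \<phi> x) = 0"
  shows "AE x in lebesgue_on U. f x = 0"
proof -
  have neg: "negligible {x \<in> cbox a b. f x \<noteq> 0}" if sub: "cbox a b \<subseteq> U" for a b
  proof -
    define g where "g x = (if x \<in> cbox a b then f x else 0)" for x
    have "f integrable_on cbox a b"
      using f sub by (intro integrable_on_lebesgue_on) (auto simp: locally_integrable_def)
    then have "g integrable_on UNIV"
      unfolding g_def by (simp add: integrable_restrict_UNIV)
    then have "g integrable_on cbox c d" for c d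
      by (rule integrable_on_subcbox) simp
    then obtain N where N: "negligible N"
      and conv: "\<And>x e. \<lbrakk>x \<notin> N; 0 < e\<rbrakk> \<Longrightarrow> \<exists>d>0. \<forall>h. 0 < h \<and> h < d \<longrightarrow>
           norm (integral (cbox x (x + h *\<^sub>R One)) g /\<^sub>R h ^ DIM('a) - g x) < e"
      using integrable_ccontinuous_explicit[of g] by blast
    have "f x = 0" if x: "x \<in> box a b" "x \<notin> N" for x
    proof (rule ccontr)
      assume "f x \<noteq> 0"
      then obtain d where d: "d > 0" and small: "\<And>h. 0 < h \<Longrightarrow> h < d \<Longrightarrow>
           norm (integral (cbox x (x + h *\<^sub>R One)) g /\<^sub>R h ^ DIM('a) - g x) < \<bar>f x\<bar>"
        using conv[OF x(2), of "\<bar>f x\<bar>"] by auto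
      have "eventually (\<lambda>h. h < b \<bullet> i - x \<bullet> i) (at_right 0)" if "i \<in> Basis" for i
        using x that by (intro order_tendstoD[OF tendsto_ident_at]) (auto simp: mem_box)
      then have "eventually (\<lambda>h. \<forall>i\<in>Basis. h < b \<bullet> i - x \<bullet> i) (at_right 0)"
        by (simp add: eventually_ball_finite)
      moreover have "eventually (\<lambda>h. h < d) (at_right (0::real))"
        using d by (intro order_tendstoD[OF tendsto_ident_at])
      ultimately have "eventually (\<lambda>h. (\<forall>i\<in>Basis. h < b \<bullet> i - x \<bullet> i) \<and> h < d \<and> h > 0) (at_right 0)"
        using eventually_at_right_less by eventually_elim auto
      then obtain h where h: "\<And>i. i \<in> Basis \<Longrightarrow> h < b \<bullet> i - x \<bullet> i" "0 < h" "h < d"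
        using eventually_happens'[OF trivial_limit_at_right_real] by blast
      have inner: "cbox x (x + h *\<^sub>R One) \<subseteq> cbox a b"
        using h x by (fastforce simp: subset_box mem_box inner_simps)
      then have "integral (cbox x (x + h *\<^sub>R One)) g = integral (cbox x (x + h *\<^sub>R One)) f"
        by (intro integral_cong) (auto simp: g_def)
      also have "\<dots> = 0"
        using box_integral_eq_0_if_orthogonal_to_bumps[OF U f orth] inner sub by blast
      finally show False
        using small[OF h(2,3)] x subsetD[OF box_subset_cbox x(1)] by (simp add: g_def)
    qed
    then have "{x \<in> cbox a b. f x \<noteq> 0} \<subseteq> N \<union> (cbox a b - box a b)" by auto
    with N negligible_frontier_interval show ?thesis
      by (metis negligible_Un negligible_subset)
  qed
  obtain \<D> where \<D>: "countable \<D>" "\<D> \<subseteq> Pow U" "\<And>X. X \<in> \<D> \<Longrightarrow> \<exists>a b. X = cbox a b" "\<Union>\<D> = U"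
    using open_countable_Union_open_cbox[OF U] by metis
  have "negligible (\<Union>X\<in>\<D>. {x \<in> X. f x \<noteq> 0})"
    using \<D> neg by (intro negligible_countable_Union) (auto, metis PowD subset_iff)
  moreover have "{x \<in> U. f x \<noteq> 0} = (\<Union>X\<in>\<D>. {x \<in> X. f x \<noteq> 0})"
    using \<D>(4) by auto
  ultimately show ?thesis
    using U by (simp add: AE_lebesgue_on_iff_negligible)
qed

lemma
  fixes F :: "'a::euclidean_space \<Rightarrow> real"
  assumes cont: "continuous_on UNIV F" and K: "compact K" and zero: "\<And>x. x \<notin> K \<Longrightarrow> F x = 0"
  shows integrable_compact_support: "integrable lborel F"
    and integral_on_compact_support: "\<Omega> \<in> sets lebesgue \<Longrightarrow> K \<subseteq> \<Omega> \<Longrightarrow> integral\<^sup>L (lebesgue_on \<Omega>) F = integral\<^sup>L lborel F"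
proof -
  have eq: "(\<lambda>x. indicator S x *\<^sub>R F x) = F" if "K \<subseteq> S" for S
    using zero that by (auto simp: indicator_def fun_eq_iff)
  show 1: "integrable lborel F"
    using borel_integrable_compact[OF K continuous_on_subset[OF cont]] eq[of K] by simp
  assume \<Omega>: "\<Omega> \<in> sets lebesgue" "K \<subseteq> \<Omega>"
  have F: "F \<in> borel_measurable lborel"
    using 1 by blast
  show "integral\<^sup>L (lebesgue_on \<Omega>) F = integral\<^sup>L lborel F"
    using \<Omega> F by (simp only: integral_restrict_space eq integral_completion space_completion space_lborel space_borel Int_UNIV_right)
qed

text \<open>
  This is the divergence theorem without boundary term, which gives integration by parts.
  By translation invariance the difference quotients of \<open>h\<close> in direction \<open>i\<close> have integral
  zero; they are bounded by the maximum of the derivative and vanish outside a fixed ball,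
  so dominated convergence applies.
\<close>

lemma integral_directional_derivative_eq_0:
  fixes h :: "'a::euclidean_space \<Rightarrow> real"
  assumes i: "norm i = 1"
    and diff: "\<And>x. h differentiable (at x)"
    and cont: "continuous_on UNIV (\<lambda>x. frechet_derivative h (at x) i)"
    and K: "compact K" and zero: "\<And>x. x \<notin> K \<Longrightarrow> h x = 0"
  shows "(\<integral>x. frechet_derivative h (at x) i \<partial>lborel) = 0"
proof -
  let ?D = "\<lambda>x. frechet_derivative h (at x) i"
  have cont_h: "continuous_on UNIV h"
    using diff by (simp add: continuous_at_imp_continuous_on differentiable_imp_continuous_within)
  have D0: "?D x = 0" if "x \<notin> K" for x
  proof -
    have "(h has_derivative (\<lambda>_. 0)) (at x)"
      by (rule has_derivative_transform_within_open[of "\<lambda>_. 0" _ _ _ "- K"])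
        (use that K zero compact_imp_closed in auto)
    then show ?thesis using frechet_derivative_at by metis
  qed
  obtain B where B: "\<And>x. \<bar>?D x\<bar> \<le> B"
  proof -
    have "bounded (?D ` K)"
      using K cont by (meson compact_continuous_image compact_imp_bounded continuous_on_subset subset_UNIV)
    then obtain B where "\<And>x. x \<in> K \<Longrightarrow> \<bar>?D x\<bar> \<le> B" by (auto simp: bounded_iff)
    then have "\<bar>?D x\<bar> \<le> max B 0" for x using D0[of x] by (cases "x \<in> K") (auto simp: le_max_iff_disj)
    then show thesis by (rule that)
  qed
  obtain R where R: "\<And>x. x \<in> K \<Longrightarrow> norm x \<le> R"
    using K compact_imp_bounded bounded_iff by metis
  have line: "((\<lambda>t. h (x + t *\<^sub>R i)) has_real_derivative ?D (x + t *\<^sub>R i)) (at t)" for x t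
  proof -
    have "(h has_derivative frechet_derivative h (at (x + t *\<^sub>R i))) (at (x + t *\<^sub>R i))"
      using diff by (simp add: frechet_derivative_works)
    moreover have "((\<lambda>t. x + t *\<^sub>R i) has_derivative (\<lambda>s. s *\<^sub>R i)) (at t)"
      by (auto intro!: derivative_eq_intros)
    ultimately have "((\<lambda>t. h (x + t *\<^sub>R i)) has_derivative
        (\<lambda>s. frechet_derivative h (at (x + t *\<^sub>R i)) (s *\<^sub>R i))) (at t)"
      using has_derivative_compose[of "\<lambda>t. x + t *\<^sub>R i" "\<lambda>s. s *\<^sub>R i" t UNIV h] by simp
    moreover have "frechet_derivative h (at (x + t *\<^sub>R i)) (s *\<^sub>R i) = ?D (x + t *\<^sub>R i) * s" for s
      using linear_frechet_derivative[OF diff] by (simp add: linear_scale)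
    ultimately show ?thesis by (simp add: has_field_derivative_def)
  qed
  \<comment> \<open>Step sizes of at most 1 keep the supports of all difference quotients in the ball of radius \<open>R + 1\<close>.\<close>
  define e :: "nat \<Rightarrow> real" where "e m = inverse (real (Suc m))" for m
  have e: "0 < e m" "e m \<le> 1" for m by (auto simp: e_def inverse_le_1_iff)
  define q where "q m x = (h (x + e m *\<^sub>R i) - h x) / e m" for m x
  have cont_q: "continuous_on UNIV (q m)" for m
    unfolding q_def using e[of m] cont_h
    by (intro continuous_intros continuous_on_compose2[OF cont_h]) auto
  have int_h: "integrable lborel h"
    using integrable_compact_support[OF cont_h K zero] by blast
  have int_q: "integral\<^sup>L lborel (q m) = 0" for m
  proof -
    have distr: "distr lborel borel ((+) (e m *\<^sub>R i)) = lborel"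
      by (rule lborel_distr_plus)
    have meas: "h \<in> borel_measurable borel" using cont_h by (rule borel_measurable_continuous_onI)
    have "integrable lborel (\<lambda>x. h (e m *\<^sub>R i + x))"
      using int_h meas integrable_distr_eq[of "(+) (e m *\<^sub>R i)" lborel borel h] distr by simp
    moreover have "integral\<^sup>L lborel (\<lambda>x. h (e m *\<^sub>R i + x)) = integral\<^sup>L lborel h"
      using meas integral_distr[of "(+) (e m *\<^sub>R i)" lborel borel h] distr by simp
    ultimately show ?thesis using int_h by (simp add: q_def[abs_def] add.commute)
  qed
  have bound_q: "\<bar>q m x\<bar> \<le> indicator (cball 0 (R + 1)) x * B" for m x
  proof (cases "x \<in> cball 0 (R + 1)")
    case True
    obtain z where "h (x + e m *\<^sub>R i) - h (x + 0 *\<^sub>R i) = (e m - 0) * ?D (x + z *\<^sub>R i)"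
      using MVT2[of 0 "e m" "\<lambda>t. h (x + t *\<^sub>R i)" "\<lambda>t. ?D (x + t *\<^sub>R i)"] line e by blast
    then have "q m x = ?D (x + z *\<^sub>R i)" using e[of m] by (simp add: q_def)
    then show ?thesis using True B by simp
  next
    case False
    then have "norm x > R + 1" by simp
    moreover have "norm x \<le> norm (x + e m *\<^sub>R i) + e m"
      using norm_triangle_ineq4[of "x + e m *\<^sub>R i" "e m *\<^sub>R i"] i e[of m] by simp
    ultimately have "x \<notin> K" "x + e m *\<^sub>R i \<notin> K"
      using R[of x] R[of "x + e m *\<^sub>R i"] e[of m] by auto
    then show ?thesis using False by (simp add: q_def zero)
  qed
  have lim: "(\<lambda>m. q m x) \<longlonglongrightarrow> ?D x" for x
  proof -
    have "((\<lambda>t. (h (x + t *\<^sub>R i) - h x) / t) \<longlongrightarrow> ?D x) (at 0)"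
      using line[of x 0] by (simp add: DERIV_def)
    moreover have "filterlim e (at 0) sequentially"
      unfolding filterlim_at using LIMSEQ_inverse_real_of_nat by (auto simp: e_def[abs_def])
    ultimately show ?thesis unfolding q_def by (rule filterlim_compose)
  qed
  have "(\<lambda>m. integral\<^sup>L lborel (q m)) \<longlonglongrightarrow> (\<integral>x. ?D x \<partial>lborel)"
  proof (rule integral_dominated_convergence)
    show "integrable lborel (\<lambda>x::'a. indicator (cball 0 (R + 1)) x * B)"
      using borel_integrable_compact[of "cball (0::'a) (R + 1)" "\<lambda>_. B"] by simp
    show "(\<lambda>x. ?D x) \<in> borel_measurable lborel" "q m \<in> borel_measurable lborel" for m
      using cont cont_q by (auto intro: borel_measurable_continuous_onI)
    show "AE x in lborel. (\<lambda>m. q m x) \<longlonglongrightarrow> ?D x" using lim by simp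
    show "AE x in lborel. norm (q m x) \<le> indicator (cball 0 (R + 1)) x * B" for m
      using bound_q by simp
  qed
  then show ?thesis by (simp add: int_q LIMSEQ_const_iff)
qed

section \<open>Weak gradients\<close>

definition grad :: "('a::euclidean_space \<Rightarrow> real) \<Rightarrow> 'a \<Rightarrow> 'a" where
  "grad \<phi> x = (\<Sum>i\<in>Basis. frechet_derivative \<phi> (at x) i *\<^sub>R i)"

lemma grad_inner_Basis: "i \<in> Basis \<Longrightarrow> grad \<phi> x \<bullet> i = frechet_derivative \<phi> (at x) i"
  by (simp add: grad_def inner_sum_left_Basis)

lemma Cc_inf_mono: "U \<subseteq> V \<Longrightarrow> Cc_inf U \<subseteq> Cc_inf V"
  by (auto simp: Cc_inf_def)

lemma Cc_inf_differentiable: "\<phi> \<in> Cc_inf U \<Longrightarrow> \<phi> differentiable (at x)"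
  by (auto simp: Cc_inf_def dest!: spec[of _ "Suc 0"])

lemma Cc_inf_continuous: "\<phi> \<in> Cc_inf U \<Longrightarrow> continuous_on UNIV \<phi>"
  by (auto simp: Cc_inf_def dest!: spec[of _ "0"])

lemma Cc_inf_continuous_derivative:
  "\<phi> \<in> Cc_inf U \<Longrightarrow> i \<in> Basis \<Longrightarrow> continuous_on UNIV (\<lambda>x. frechet_derivative \<phi> (at x) i)"
  by (auto simp: Cc_inf_def dest!: spec[of _ "Suc 0"])

lemma Cc_inf_continuous_grad: "\<phi> \<in> Cc_inf U \<Longrightarrow> continuous_on UNIV (grad \<phi>)"
  unfolding grad_def by (intro continuous_intros Cc_inf_continuous_derivative)

lemma Cc_inf_support:
  assumes "\<phi> \<in> Cc_inf U"
  obtains K where "compact K" "K \<subseteq> U" "\<And>x. x \<notin> K \<Longrightarrow> \<phi> x = 0"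
    "\<And>x i. x \<notin> K \<Longrightarrow> frechet_derivative \<phi> (at x) i = 0" "\<And>x. x \<notin> K \<Longrightarrow> grad \<phi> x = 0"
proof -
  let ?K = "closure (support_on UNIV \<phi>)"
  have K: "compact ?K" "?K \<subseteq> U" using assms by (auto simp: Cc_inf_def)
  have zero: "\<phi> x = 0" if "x \<notin> ?K" for x
    using that closure_subset by (force simp: support_on_def)
  have dzero: "frechet_derivative \<phi> (at x) i = 0" if "x \<notin> ?K" for x i
  proof -
    have "(\<phi> has_derivative (\<lambda>_. 0)) (at x)"
      by (rule has_derivative_transform_within_open[of "\<lambda>_. 0" _ _ _ "- ?K"])
        (use that zero in auto)
    then show ?thesis using frechet_derivative_at by metis
  qed
  then have "grad \<phi> x = 0" if "x \<notin> ?K" for x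
    using that by (simp add: grad_def)
  with K zero dzero show thesis by (rule that)
qed

lemma Cc_inf_bounded:
  assumes "\<phi> \<in> Cc_inf U"
  obtains B where "\<And>x. \<bar>\<phi> x\<bar> \<le> B" "\<And>x. norm (grad \<phi> x) \<le> B"
proof -
  obtain K where K: "compact K" "\<And>x. x \<notin> K \<Longrightarrow> \<phi> x = 0" "\<And>x. x \<notin> K \<Longrightarrow> grad \<phi> x = 0"
    using Cc_inf_support[OF assms] by metis
  have "bounded (\<phi> ` K)" "bounded (grad \<phi> ` K)"
    using K Cc_inf_continuous[OF assms] Cc_inf_continuous_grad[OF assms]
    by (meson compact_continuous_image compact_imp_bounded continuous_on_subset subset_UNIV)+
  then obtain B1 B2 where "\<And>x. x \<in> K \<Longrightarrow> \<bar>\<phi> x\<bar> \<le> B1" "\<And>x. x \<in> K \<Longrightarrow> norm (grad \<phi> x) \<le> B2"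
    by (auto simp: bounded_iff)
  then have "\<bar>\<phi> x\<bar> \<le> max 0 (max B1 B2)" "norm (grad \<phi> x) \<le> max 0 (max B1 B2)" for x
    using K(2,3)[of x] by (cases "x \<in> K"; force simp: le_max_iff_disj)+
  then show thesis by (rule that)
qed

lemma locally_integrable_continuous:
  assumes "continuous_on UNIV f" shows "locally_integrable \<Omega> f"
  unfolding locally_integrable_def
proof (intro allI impI)
  fix K :: "'a set" assume K: "compact K \<and> K \<subseteq> \<Omega>"
  then have "integrable lborel (\<lambda>x. indicator K x *\<^sub>R f x)"
    using assms by (intro borel_integrable_compact) (auto intro: continuous_on_subset)
  then have "integrable lebesgue (\<lambda>x. indicator K x *\<^sub>R f x)"
    by (subst integrable_completion) (auto dest: borel_measurable_integrable)
  then show "integrable (lebesgue_on K) f"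
    using K by (subst integrable_restrict_space) (auto simp: compact_imp_closed)
qed

lemma locally_integrable_add_scaleR:
  assumes "locally_integrable \<Omega> f" "locally_integrable \<Omega> g"
  shows "locally_integrable \<Omega> (\<lambda>x. f x + c *\<^sub>R g x)"
  using assms by (auto simp: locally_integrable_def)

lemma locally_integrable_inner:
  assumes "locally_integrable \<Omega> f" shows "locally_integrable \<Omega> (\<lambda>x. f x \<bullet> i)"
  using assms by (auto simp: locally_integrable_def)

lemma integrable_mult_compact_support:
  fixes f \<psi> :: "'a::euclidean_space \<Rightarrow> real"
  assumes \<Omega>: "\<Omega> \<in> sets lebesgue" and f: "locally_integrable \<Omega> f" and cont: "continuous_on UNIV \<psi>"
    and K: "compact K" "K \<subseteq> \<Omega>" and zero: "\<And>x. x \<notin> K \<Longrightarrow> \<psi> x = 0"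
  shows "integrable (lebesgue_on \<Omega>) (\<lambda>x. f x * \<psi> x)"
proof -
  have int: "integrable (lebesgue_on K) f"
    using f K by (auto simp: locally_integrable_def)
  have "bounded (\<psi> ` K)"
    using K cont by (meson compact_continuous_image compact_imp_bounded continuous_on_subset subset_UNIV)
  then obtain B where B: "\<And>x. x \<in> K \<Longrightarrow> \<bar>\<psi> x\<bar> \<le> B" by (auto simp: bounded_iff)
  have meas: "\<psi> \<in> borel_measurable (lebesgue_on K)"
    using cont by (intro measurable_restrict_space1 measurable_completion) (auto intro: borel_measurable_continuous_onI)
  have "integrable (lebesgue_on K) (\<lambda>x. f x * \<psi> x)"
  proof (rule Bochner_Integration.integrable_bound)
    show "integrable (lebesgue_on K) (\<lambda>x. B * f x)" using int by simp
    show "(\<lambda>x. f x * \<psi> x) \<in> borel_measurable (lebesgue_on K)"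
      using int meas by (auto intro: borel_measurable_times)
    show "AE x in lebesgue_on K. norm (f x * \<psi> x) \<le> norm (B * f x)"
      using B by (intro AE_I2) (auto simp: abs_mult mult.commute intro!: mult_right_mono order_trans[OF B abs_ge_self])
  qed
  moreover have "K \<in> sets lebesgue" using K by (simp add: compact_imp_closed)
  ultimately have "integrable lebesgue (\<lambda>x. indicator K x *\<^sub>R (f x * \<psi> x))"
    by (subst (asm) integrable_restrict_space) auto
  moreover have "(\<lambda>x. indicator K x *\<^sub>R (f x * \<psi> x)) = (\<lambda>x. indicator \<Omega> x *\<^sub>R (f x * \<psi> x))"
    using K zero by (auto simp: indicator_def fun_eq_iff)
  ultimately show ?thesis
    using \<Omega> by (subst integrable_restrict_space) auto
qed

lemma integrable_mult_Cc_inf: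
  assumes \<Omega>: "\<Omega> \<in> sets lebesgue" and f: "locally_integrable \<Omega> f" and \<phi>: "\<phi> \<in> Cc_inf \<Omega>"
  shows "integrable (lebesgue_on \<Omega>) (\<lambda>x. f x * \<phi> x)"
    and "i \<in> Basis \<Longrightarrow> integrable (lebesgue_on \<Omega>) (\<lambda>x. f x * frechet_derivative \<phi> (at x) i)"
proof -
  obtain K where "compact K" "K \<subseteq> \<Omega>" "\<And>x. x \<notin> K \<Longrightarrow> \<phi> x = 0"
    "\<And>x i. x \<notin> K \<Longrightarrow> frechet_derivative \<phi> (at x) i = 0"
    using Cc_inf_support[OF \<phi>] by metis
  then show "integrable (lebesgue_on \<Omega>) (\<lambda>x. f x * \<phi> x)"
    "i \<in> Basis \<Longrightarrow> integrable (lebesgue_on \<Omega>) (\<lambda>x. f x * frechet_derivative \<phi> (at x) i)"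
    using \<Omega> f Cc_inf_continuous[OF \<phi>] Cc_inf_continuous_derivative[OF \<phi>]
    by (auto intro!: integrable_mult_compact_support)
qed

text \<open>
  Integrate the derivative of the product \<open>\<phi> * \<psi>\<close>, which is again compactly supported.
\<close>

lemma has_weak_gradient_Cc_inf:
  assumes \<Omega>: "open \<Omega>" and \<phi>: "\<phi> \<in> Cc_inf \<Omega>"
  shows "has_weak_gradient \<Omega> \<phi> (grad \<phi>)"
  unfolding has_weak_gradient_def
proof (intro conjI ballI)
  show loc: "locally_integrable \<Omega> \<phi>" "locally_integrable \<Omega> (grad \<phi>)"
    using Cc_inf_continuous[OF \<phi>] Cc_inf_continuous_grad[OF \<phi>] by (auto intro: locally_integrable_continuous)
  fix \<psi> and i :: 'a assume \<psi>: "\<psi> \<in> Cc_inf \<Omega>" and i: "i \<in> Basis"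
  note loc' = locally_integrable_inner[OF loc(2), of i, unfolded grad_inner_Basis[OF i]]
  have D: "frechet_derivative (\<lambda>x. \<phi> x * \<psi> x) (at x) i
      = \<phi> x * frechet_derivative \<psi> (at x) i + frechet_derivative \<phi> (at x) i * \<psi> x"
    and diff: "(\<lambda>x. \<phi> x * \<psi> x) differentiable (at x)" for x
  proof -
    have "((\<lambda>x. \<phi> x * \<psi> x) has_derivative
        (\<lambda>i. \<phi> x * frechet_derivative \<psi> (at x) i + frechet_derivative \<phi> (at x) i * \<psi> x)) (at x)"
      using Cc_inf_differentiable[OF \<phi>] Cc_inf_differentiable[OF \<psi>]
      by (intro has_derivative_mult) (auto simp: frechet_derivative_works)
    from this frechet_derivative_at[OF this, symmetric]
    show "frechet_derivative (\<lambda>x. \<phi> x * \<psi> x) (at x) i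
      = \<phi> x * frechet_derivative \<psi> (at x) i + frechet_derivative \<phi> (at x) i * \<psi> x"
      "(\<lambda>x. \<phi> x * \<psi> x) differentiable (at x)"
      by (auto simp: differentiable_def)
  qed
  obtain K where K: "compact K" "K \<subseteq> \<Omega>" "\<And>x. x \<notin> K \<Longrightarrow> \<phi> x = 0"
    "\<And>x i. x \<notin> K \<Longrightarrow> frechet_derivative \<phi> (at x) i = 0"
    using Cc_inf_support[OF \<phi>] by metis
  have cont: "continuous_on UNIV (\<lambda>x. frechet_derivative (\<lambda>x. \<phi> x * \<psi> x) (at x) i)"
    unfolding D using \<phi> \<psi> i
    by (intro continuous_intros Cc_inf_continuous Cc_inf_continuous_derivative)
  have "(LINT x|lebesgue_on \<Omega>. frechet_derivative (\<lambda>x. \<phi> x * \<psi> x) (at x) i)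
      = (LINT x|lborel. frechet_derivative (\<lambda>x. \<phi> x * \<psi> x) (at x) i)"
    using K \<Omega> by (intro integral_on_compact_support[OF cont K(1)]) (auto simp: D)
  also have "\<dots> = 0"
    using K i by (intro integral_directional_derivative_eq_0[OF _ diff cont K(1)]) auto
  finally have "(LINT x|lebesgue_on \<Omega>. \<phi> x * frechet_derivative \<psi> (at x) i)
      + (LINT x|lebesgue_on \<Omega>. frechet_derivative \<phi> (at x) i * \<psi> x) = 0"
    unfolding D using \<Omega> i
    by (subst (asm) Bochner_Integration.integral_add)
       (auto intro: integrable_mult_Cc_inf(2)[OF _ loc(1) \<psi> i] integrable_mult_Cc_inf(1)[OF _ loc' \<psi>])
  then show "(LINT x|lebesgue_on \<Omega>. \<phi> x * frechet_derivative \<psi> (at x) i)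
      = - (LINT x|lebesgue_on \<Omega>. (grad \<phi> x \<bullet> i) * \<psi> x)"
    using i by (simp add: grad_inner_Basis)
qed

text \<open>
  The difference of two weak gradients is orthogonal to all test functions.
\<close>

lemma has_weak_gradient_unique:
  assumes \<Omega>: "open \<Omega>" and g: "has_weak_gradient \<Omega> u g" and h: "has_weak_gradient \<Omega> u h"
  shows "AE x in lebesgue_on \<Omega>. g x = h x"
proof -
  have "AE x in lebesgue_on \<Omega>. (g x - h x) \<bullet> i = 0" if i: "i \<in> Basis" for i
  proof (rule fundamental_lemma_calculus_of_variations[OF \<Omega>])
    have loc: "locally_integrable \<Omega> (\<lambda>x. g x \<bullet> i)" "locally_integrable \<Omega> (\<lambda>x. h x \<bullet> i)"
      using g h by (auto simp: has_weak_gradient_def intro: locally_integrable_inner)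
    show "locally_integrable \<Omega> (\<lambda>x. (g x - h x) \<bullet> i)"
      using locally_integrable_add_scaleR[OF loc, of "-1"] by (simp add: inner_diff_left)
    fix \<phi> assume \<phi>: "\<phi> \<in> Cc_inf \<Omega>"
    have "(LINT x|lebesgue_on \<Omega>. (g x \<bullet> i) * \<phi> x) = (LINT x|lebesgue_on \<Omega>. (h x \<bullet> i) * \<phi> x)"
      using g h \<phi> i by (auto simp: has_weak_gradient_def)
    then show "(LINT x|lebesgue_on \<Omega>. (g x - h x) \<bullet> i * \<phi> x) = 0"
      using \<Omega> integrable_mult_Cc_inf(1)[OF _ loc(1) \<phi>] integrable_mult_Cc_inf(1)[OF _ loc(2) \<phi>]
      by (simp add: inner_diff_left left_diff_distrib)
  qed
  then have "AE x in lebesgue_on \<Omega>. \<forall>i\<in>Basis. (g x - h x) \<bullet> i = 0"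
    by (intro AE_finite_allI) auto
  then show ?thesis
    by eventually_elim (metis eq_iff_diff_eq_0 euclidean_eqI inner_zero_left)
qed

lemma has_weak_gradient_add_scale:
  assumes \<Omega>: "open \<Omega>" and u: "has_weak_gradient \<Omega> u g" and v: "has_weak_gradient \<Omega> v h"
  shows "has_weak_gradient \<Omega> (\<lambda>x. u x + c * v x) (\<lambda>x. g x + c *\<^sub>R h x)"
  unfolding has_weak_gradient_def
proof (intro conjI ballI)
  show "locally_integrable \<Omega> (\<lambda>x. u x + c * v x)" "locally_integrable \<Omega> (\<lambda>x. g x + c *\<^sub>R h x)"
    using u v locally_integrable_add_scaleR[of \<Omega> u v c] locally_integrable_add_scaleR[of \<Omega> g h c]
    by (auto simp: has_weak_gradient_def)
  fix \<phi> and i :: 'a assume \<phi>: "\<phi> \<in> Cc_inf \<Omega>" and i: "i \<in> Basis"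
  have M: "\<Omega> \<in> sets lebesgue" using \<Omega> by simp
  have loc: "locally_integrable \<Omega> u" "locally_integrable \<Omega> v"
     "locally_integrable \<Omega> (\<lambda>x. g x \<bullet> i)" "locally_integrable \<Omega> (\<lambda>x. h x \<bullet> i)"
    using u v by (auto simp: has_weak_gradient_def intro: locally_integrable_inner)
  note int = integrable_mult_Cc_inf(2)[OF M loc(1) \<phi> i] integrable_mult_Cc_inf(2)[OF M loc(2) \<phi> i]
     integrable_mult_Cc_inf(1)[OF M loc(3) \<phi>] integrable_mult_Cc_inf(1)[OF M loc(4) \<phi>]
  have eq: "(LINT x|lebesgue_on \<Omega>. u x * frechet_derivative \<phi> (at x) i) = - (LINT x|lebesgue_on \<Omega>. (g x \<bullet> i) * \<phi> x)"
    "(LINT x|lebesgue_on \<Omega>. v x * frechet_derivative \<phi> (at x) i) = - (LINT x|lebesgue_on \<Omega>. (h x \<bullet> i) * \<phi> x)"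
    using u v \<phi> i by (auto simp: has_weak_gradient_def)
  show "(LINT x|lebesgue_on \<Omega>. (u x + c * v x) * frechet_derivative \<phi> (at x) i)
      = - (LINT x|lebesgue_on \<Omega>. ((g x + c *\<^sub>R h x) \<bullet> i) * \<phi> x)"
    using int eq by (simp add: inner_add_left distrib_right mult.assoc)
qed

section \<open>Essentially bounded functions and the Sobolev space\<close>

lemma borel_measurable_lebesgue_on_AE_cong:
  fixes f g :: "'a::euclidean_space \<Rightarrow> 'b::euclidean_space"
  assumes S: "S \<in> sets lebesgue" and f: "f \<in> borel_measurable (lebesgue_on S)"
    and eq: "AE x in lebesgue_on S. f x = g x"
  shows "g \<in> borel_measurable (lebesgue_on S)"
proof -
  let ?N = "{x \<in> S. f x \<noteq> g x}"
  have N: "?N \<in> null_sets (lebesgue_on S)"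
    using eq S by (auto simp: AE_lebesgue_on_iff_negligible null_sets_restrict_space negligible_iff_null_sets)
  have "f \<in> borel_measurable (lebesgue_on (S - ?N))"
    using borel_measurable_diff_null[OF N S, of f] f by blast
  then have "g \<in> borel_measurable (lebesgue_on (S - ?N))"
    by (rule measurable_cong[THEN iffD1, rotated]) auto
  then show ?thesis
    using borel_measurable_diff_null[OF N S, of g] by blast
qed

lemma Linf_norm_le:
  assumes "f \<in> borel_measurable (lebesgue_on S)" "AE x in lebesgue_on S. norm (f x) \<le> B"
  shows "Linf_norm S f \<le> ennreal B"
  unfolding Linf_norm_def using assms by (intro esssup_I) (auto elim!: eventually_mono intro: ennreal_leI)

lemma LinfI:
  assumes "f \<in> borel_measurable (lebesgue_on S)" "AE x in lebesgue_on S. norm (f x) \<le> B"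
  shows "f \<in> Linf S"
  using Linf_norm_le[OF assms] assms(1) by (auto simp: Linf_def intro: le_less_trans)

lemma Linf_norm_bound_AE:
  assumes "Linf_norm S f < \<infinity>"
  shows "AE x in lebesgue_on S. norm (f x) \<le> enn2real (Linf_norm S f)"
proof -
  have "AE x in lebesgue_on S. ennreal (norm (f x)) \<le> Linf_norm S f"
    unfolding Linf_norm_def by (rule esssup_AE)
  then show ?thesis
    by (rule eventually_mono) (use assms enn2real_mono in fastforce)
qed

lemma Linf_bound_AE:
  "f \<in> Linf S \<Longrightarrow> AE x in lebesgue_on S. norm (f x) \<le> enn2real (Linf_norm S f)"
  by (rule Linf_norm_bound_AE) (simp add: Linf_def)

lemma
  fixes f g :: "'a::euclidean_space \<Rightarrow> 'b::euclidean_space"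
  assumes f: "f \<in> Linf S" and g: "g \<in> Linf S"
  shows Linf_add_scaleR: "(\<lambda>x. f x + c *\<^sub>R g x) \<in> Linf S"
    and Linf_norm_add_scaleR: "enn2real (Linf_norm S (\<lambda>x. f x + c *\<^sub>R g x))
      \<le> enn2real (Linf_norm S f) + \<bar>c\<bar> * enn2real (Linf_norm S g)"
proof -
  have meas: "(\<lambda>x. f x + c *\<^sub>R g x) \<in> borel_measurable (lebesgue_on S)"
    using f g by (auto simp: Linf_def)
  have bound: "AE x in lebesgue_on S. norm (f x + c *\<^sub>R g x)
      \<le> enn2real (Linf_norm S f) + \<bar>c\<bar> * enn2real (Linf_norm S g)"
    using Linf_bound_AE[OF f] Linf_bound_AE[OF g]
  proof eventually_elim
    case (elim x)
    have "norm (f x + c *\<^sub>R g x) \<le> norm (f x) + \<bar>c\<bar> * norm (g x)"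
      by (metis norm_scaleR norm_triangle_ineq)
    also have "\<dots> \<le> enn2real (Linf_norm S f) + \<bar>c\<bar> * enn2real (Linf_norm S g)"
      using elim by (intro add_mono mult_left_mono) auto
    finally show ?case .
  qed
  show "(\<lambda>x. f x + c *\<^sub>R g x) \<in> Linf S" using LinfI[OF meas bound] .
  show "enn2real (Linf_norm S (\<lambda>x. f x + c *\<^sub>R g x))
      \<le> enn2real (Linf_norm S f) + \<bar>c\<bar> * enn2real (Linf_norm S g)"
    by (intro enn2real_leI Linf_norm_le[OF meas bound]) auto
qed

lemma has_weak_gradient_weak_grad:
  "u \<in> W1inf \<Omega> \<Longrightarrow> has_weak_gradient \<Omega> u (weak_grad \<Omega> u)"
  using someI_ex[of "has_weak_gradient \<Omega> u"] by (auto simp: W1inf_def weak_grad_def)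

lemma weak_grad_AE_eq:
  assumes "open \<Omega>" "has_weak_gradient \<Omega> u g"
  shows "AE x in lebesgue_on \<Omega>. weak_grad \<Omega> u x = g x"
  using has_weak_gradient_unique[OF assms(1) someI[of "has_weak_gradient \<Omega> u", OF assms(2)] assms(2)]
  by (simp add: weak_grad_def)

text \<open>
  The chosen weak gradient need not be the essentially bounded one whose existence defines
  \<open>W1inf\<close>, but it agrees with it almost everywhere; completeness of Lebesgue measure
  then gives its measurability.
\<close>

lemma weak_grad_Linf:
  assumes "open \<Omega>" "u \<in> W1inf \<Omega>" shows "weak_grad \<Omega> u \<in> Linf \<Omega>"
proof -
  obtain g where g: "g \<in> Linf \<Omega>" "has_weak_gradient \<Omega> u g"
    using assms by (auto simp: W1inf_def)
  have eq: "AE x in lebesgue_on \<Omega>. weak_grad \<Omega> u x = g x"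
    using assms g by (intro weak_grad_AE_eq)
  have "AE x in lebesgue_on \<Omega>. norm (weak_grad \<Omega> u x) \<le> enn2real (Linf_norm \<Omega> g)"
    using eq Linf_bound_AE[OF g(1)] by eventually_elim simp
  moreover have "weak_grad \<Omega> u \<in> borel_measurable (lebesgue_on \<Omega>)"
  proof (rule borel_measurable_lebesgue_on_AE_cong)
    show "AE x in lebesgue_on \<Omega>. g x = weak_grad \<Omega> u x" using eq by (simp only: eq_commute)
  qed (use g(1) assms(1) in \<open>auto simp: Linf_def\<close>)
  ultimately show ?thesis by (metis LinfI)
qed

lemma
  assumes \<Omega>: "open \<Omega>" and u: "u \<in> W1inf \<Omega>" and v: "v \<in> W1inf \<Omega>"
  shows W1inf_add_scale: "(\<lambda>x. u x + c * v x) \<in> W1inf \<Omega>"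
    and W1inf_norm_add_scale: "W1inf_norm \<Omega> (\<lambda>x. u x + c * v x) \<le> W1inf_norm \<Omega> u + \<bar>c\<bar> * W1inf_norm \<Omega> v"
proof -
  let ?w = "\<lambda>x. u x + c * v x" and ?g = "\<lambda>x. weak_grad \<Omega> u x + c *\<^sub>R weak_grad \<Omega> v x"
  have hwg: "has_weak_gradient \<Omega> ?w ?g"
    using assms by (intro has_weak_gradient_add_scale has_weak_gradient_weak_grad)
  have g: "?g \<in> Linf \<Omega>"
    using assms by (intro Linf_add_scaleR weak_grad_Linf)
  have uv: "u \<in> Linf \<Omega>" "v \<in> Linf \<Omega>" using u v by (auto simp: W1inf_def)
  have "?w \<in> Linf \<Omega>"
    using Linf_add_scaleR[OF uv] by simp
  moreover have "continuous_on \<Omega> ?w"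
    using u v by (auto simp: W1inf_def intro!: continuous_intros)
  ultimately show W: "?w \<in> W1inf \<Omega>"
    using hwg g by (auto simp: W1inf_def)
  have eq: "AE x in lebesgue_on \<Omega>. weak_grad \<Omega> ?w x = ?g x"
    using \<Omega> hwg by (rule weak_grad_AE_eq)
  have "Linf_norm \<Omega> (weak_grad \<Omega> ?w) = Linf_norm \<Omega> ?g"
    unfolding Linf_norm_def using eq weak_grad_Linf[OF \<Omega> W] g
    by (intro esssup_AE_cong) (auto simp: Linf_def)
  then show "W1inf_norm \<Omega> ?w \<le> W1inf_norm \<Omega> u + \<bar>c\<bar> * W1inf_norm \<Omega> v"
    using Linf_norm_add_scaleR[OF uv, of c]
      Linf_norm_add_scaleR[OF weak_grad_Linf[OF \<Omega> u] weak_grad_Linf[OF \<Omega> v], of c]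
    by (simp add: W1inf_norm_def distrib_left)
qed

lemma Cc_inf_W1inf:
  assumes "open \<Omega>" and \<phi>: "\<phi> \<in> Cc_inf \<Omega>" shows "\<phi> \<in> W1inf \<Omega>"
proof -
  obtain B where B: "\<And>x. \<bar>\<phi> x\<bar> \<le> B" "\<And>x. norm (grad \<phi> x) \<le> B"
    using Cc_inf_bounded[OF \<phi>] by metis
  have "\<phi> \<in> borel_measurable (lebesgue_on \<Omega>)" "grad \<phi> \<in> borel_measurable (lebesgue_on \<Omega>)"
    using Cc_inf_continuous[OF \<phi>] Cc_inf_continuous_grad[OF \<phi>]
    by (auto intro!: measurable_restrict_space1 measurable_completion intro: borel_measurable_continuous_onI)
  then have "\<phi> \<in> Linf \<Omega>" "grad \<phi> \<in> Linf \<Omega>"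
    using B by (auto intro!: LinfI[of _ _ B])
  then show ?thesis
    using has_weak_gradient_Cc_inf[OF assms] Cc_inf_continuous[OF \<phi>]
    by (auto simp: W1inf_def intro: continuous_on_subset)
qed

lemma zero_Linf: "(\<lambda>x. 0) \<in> Linf S" and Linf_norm_zero: "Linf_norm S (\<lambda>x. 0) = 0"
  using LinfI[of "\<lambda>x. 0" S 0] Linf_norm_le[of "\<lambda>x. 0" S 0] by auto

lemma zero_W1inf: "(\<lambda>x. 0) \<in> W1inf \<Omega>" and W1inf_norm_zero: "open \<Omega> \<Longrightarrow> W1inf_norm \<Omega> (\<lambda>x. 0) = 0"
proof -
  have hwg: "has_weak_gradient \<Omega> (\<lambda>x. 0) (\<lambda>x. 0)"
    by (simp add: has_weak_gradient_def locally_integrable_def)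
  show W: "(\<lambda>x. 0) \<in> W1inf \<Omega>"
    unfolding W1inf_def
    by (auto intro!: bexI[of "has_weak_gradient \<Omega> (\<lambda>x. 0)", OF hwg] zero_Linf)
  assume \<Omega>: "open \<Omega>"
  have "AE x in lebesgue_on \<Omega>. norm (weak_grad \<Omega> (\<lambda>x. 0) x) \<le> 0"
    using weak_grad_AE_eq[OF \<Omega> hwg] by eventually_elim simp
  then have "Linf_norm \<Omega> (weak_grad \<Omega> (\<lambda>x. 0)) \<le> ennreal 0"
    using weak_grad_Linf[OF \<Omega> W] by (intro Linf_norm_le) (auto simp: Linf_def)
  then show "W1inf_norm \<Omega> (\<lambda>x. 0) = 0"
    by (simp add: W1inf_norm_def Linf_norm_zero)
qed

lemma W1inf_scale: "open \<Omega> \<Longrightarrow> v \<in> W1inf \<Omega> \<Longrightarrow> (\<lambda>x. c * v x) \<in> W1inf \<Omega>"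
  using W1inf_add_scale[OF _ zero_W1inf, of \<Omega> v c] by simp

lemma W1inf_norm_scale: "open \<Omega> \<Longrightarrow> v \<in> W1inf \<Omega> \<Longrightarrow> W1inf_norm \<Omega> (\<lambda>x. c * v x) \<le> \<bar>c\<bar> * W1inf_norm \<Omega> v"
  using W1inf_norm_add_scale[OF _ zero_W1inf, of \<Omega> v c] by (simp add: W1inf_norm_zero)

lemma W1inf_norm_nonneg: "0 \<le> W1inf_norm \<Omega> v"
  by (simp add: W1inf_norm_def)

lemma W1inf_bound_AE:
  assumes "v \<in> W1inf \<Omega>" shows "AE x in lebesgue_on \<Omega>. \<bar>v x\<bar> \<le> W1inf_norm \<Omega> v"
proof -
  have "v \<in> Linf \<Omega>" using assms by (simp add: W1inf_def)
  from Linf_bound_AE[OF this] show ?thesis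
    by eventually_elim (auto simp: W1inf_norm_def intro: order_trans)
qed

text \<open>
  The usual argument: two candidates differ by \<open>o(norm h)\<close>, and homogeneity turns this into
  equality.  It is needed to replace the derivative picked by the choice operator by an explicit
  integral.
\<close>

lemma W1inf_derivative_unique:
  assumes \<Omega>: "open \<Omega>" and L: "has_W1inf_derivative \<Omega> F L u" and M: "has_W1inf_derivative \<Omega> F M u"
    and h: "h \<in> W1inf \<Omega>"
  shows "L h = M h"
proof -
  let ?n = "W1inf_norm \<Omega> h"
  have bound: "\<bar>L h - M h\<bar> \<le> 2 * \<epsilon> * ?n" if "\<epsilon> > 0" for \<epsilon>
  proof -
    obtain d1 where d1: "d1 > 0" "\<And>h. h \<in> W1inf \<Omega> \<Longrightarrow> W1inf_norm \<Omega> h < d1 \<Longrightarrow>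
        \<bar>F (\<lambda>x. u x + h x) - F u - L h\<bar> \<le> \<epsilon> * W1inf_norm \<Omega> h"
      using L \<open>\<epsilon> > 0\<close> unfolding has_W1inf_derivative_def by blast
    obtain d2 where d2: "d2 > 0" "\<And>h. h \<in> W1inf \<Omega> \<Longrightarrow> W1inf_norm \<Omega> h < d2 \<Longrightarrow>
        \<bar>F (\<lambda>x. u x + h x) - F u - M h\<bar> \<le> \<epsilon> * W1inf_norm \<Omega> h"
      using M \<open>\<epsilon> > 0\<close> unfolding has_W1inf_derivative_def by blast
    \<comment> \<open>The direction \<open>h\<close> is scaled into both balls of validity; the 1 covers the case of norm zero.\<close>
    define c where "c = min d1 d2 / (2 * (?n + 1))"
    have pos: "0 < min d1 d2" "0 < 2 * (?n + 1)"
      using d1(1) d2(1) W1inf_norm_nonneg[of \<Omega> h] by auto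
    then have c: "c > 0" unfolding c_def by (rule divide_pos_pos)
    have "c * ?n < c * (2 * (?n + 1))"
      using c W1inf_norm_nonneg[of \<Omega> h] by (intro mult_strict_left_mono) auto
    also have "\<dots> = min d1 d2" using pos(2) by (simp add: c_def)
    finally have cn: "c * ?n < min d1 d2" .
    let ?h = "\<lambda>x. c * h x"
    have W: "?h \<in> W1inf \<Omega>" and n: "W1inf_norm \<Omega> ?h \<le> c * ?n"
      using W1inf_scale[OF \<Omega> h] W1inf_norm_scale[OF \<Omega> h, of c] c by auto
    have "c * \<bar>L h - M h\<bar> = \<bar>L ?h - M ?h\<bar>"
      using L M h c by (simp add: has_W1inf_derivative_def right_diff_distrib[symmetric] abs_mult)
    also have "\<dots> \<le> 2 * (\<epsilon> * W1inf_norm \<Omega> ?h)"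
      using d1(2)[OF W] d2(2)[OF W] n cn by linarith
    also have "\<dots> \<le> 2 * (\<epsilon> * (c * ?n))"
      using n \<open>\<epsilon> > 0\<close> by simp
    finally have "c * \<bar>L h - M h\<bar> \<le> c * (2 * \<epsilon> * ?n)" by (simp add: algebra_simps)
    then show ?thesis using c by simp
  qed
  have "\<bar>L h - M h\<bar> \<le> 0 + e" if "e > 0" for e
  proof -
    have "\<bar>L h - M h\<bar> \<le> 2 * (e / (2 * (?n + 1))) * ?n"
      using W1inf_norm_nonneg[of \<Omega> h] that by (intro bound) auto
    also have "\<dots> \<le> e"
      using W1inf_norm_nonneg[of \<Omega> h] that by (simp add: field_simps)
    finally show ?thesis by simp
  qed
  then show ?thesis
    using field_le_epsilon[of "\<bar>L h - M h\<bar>" 0] by auto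
qed

lemma W1inf_derivative_eq:
  assumes "open \<Omega>" "has_W1inf_derivative \<Omega> F L u" "h \<in> W1inf \<Omega>"
  shows "W1inf_derivative \<Omega> F u h = L h"
  unfolding W1inf_derivative_def
  by (rule W1inf_derivative_unique[OF assms(1) someI[of "\<lambda>L. has_W1inf_derivative \<Omega> F L u", OF assms(2)] assms(2,3)])

section \<open>Derivatives of integral functionals\<close>

lemma Linf_mult:
  fixes f g :: "'a::euclidean_space \<Rightarrow> real"
  assumes f: "f \<in> Linf S" and g: "g \<in> Linf S"
  shows "(\<lambda>x. f x * g x) \<in> Linf S"
proof (rule LinfI)
  show "(\<lambda>x. f x * g x) \<in> borel_measurable (lebesgue_on S)"
    using f g by (auto simp: Linf_def)
  show "AE x in lebesgue_on S. norm (f x * g x) \<le> enn2real (Linf_norm S f) * enn2real (Linf_norm S g)"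
    using Linf_bound_AE[OF f] Linf_bound_AE[OF g]
    by eventually_elim (auto simp: abs_mult intro!: mult_mono)
qed

lemma Linf_continuous_compose:
  fixes f :: "'a::euclidean_space \<Rightarrow> real" and g :: "real \<Rightarrow> real"
  assumes f: "f \<in> Linf S" and g: "continuous_on UNIV g"
  shows "(\<lambda>x. g (f x)) \<in> Linf S"
proof -
  let ?B = "enn2real (Linf_norm S f)"
  have "bounded (g ` {- ?B .. ?B})"
    using g by (meson compact_Icc compact_continuous_image compact_imp_bounded continuous_on_subset subset_UNIV)
  then obtain C where C: "\<And>t. t \<in> {- ?B .. ?B} \<Longrightarrow> \<bar>g t\<bar> \<le> C"
    unfolding bounded_iff by fastforce
  show ?thesis
  proof (rule LinfI)
    show "(\<lambda>x. g (f x)) \<in> borel_measurable (lebesgue_on S)"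
      using f g by (auto simp: Linf_def intro!: measurable_compose[of f _ borel g] borel_measurable_continuous_onI)
    show "AE x in lebesgue_on S. norm (g (f x)) \<le> C"
      using Linf_bound_AE[OF f] by eventually_elim (auto intro!: C)
  qed
qed

lemma Linf_integrable:
  fixes f :: "'a::euclidean_space \<Rightarrow> real"
  assumes "S \<in> lmeasurable" and f: "f \<in> Linf S"
  shows "integrable (lebesgue_on S) f"
  using Linf_bound_AE[OF f] f finite_measure_lebesgue_on[OF assms(1)]
  by (intro finite_measure.integrable_const_bound) (auto simp: Linf_def)

text \<open>
  Uniform continuity of the derivative on bounded intervals makes the remainder of the first
  order expansion uniform in the base point.
\<close>

lemma C1_uniform_remainder:
  fixes f f' :: "real \<Rightarrow> real"
  assumes D: "\<And>t. (f has_real_derivative f' t) (at t)" and cont: "continuous_on UNIV f'" and e: "e > 0"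
  shows "\<exists>\<delta>>0. \<forall>y k. \<bar>y\<bar> \<le> M \<and> \<bar>k\<bar> \<le> \<delta> \<longrightarrow> \<bar>f (y + k) - f y - f' y * k\<bar> \<le> e * \<bar>k\<bar>"
proof -
  have "uniformly_continuous_on {- M - 1 .. M + 1} f'"
    using cont by (intro compact_uniformly_continuous) (auto intro: continuous_on_subset)
  then obtain d where d: "d > 0" "\<And>y z. y \<in> {- M - 1 .. M + 1} \<Longrightarrow> z \<in> {- M - 1 .. M + 1} \<Longrightarrow>
      dist z y < d \<Longrightarrow> dist (f' z) (f' y) < e"
    using e unfolding uniformly_continuous_on_def by metis
  show ?thesis
  proof (intro exI[of _ "min 1 (d / 2)"] conjI allI impI)
    show "0 < min 1 (d / 2)" using d by simp
    fix y k assume yk: "\<bar>y\<bar> \<le> M \<and> \<bar>k\<bar> \<le> min 1 (d / 2)"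
    have "\<exists>z. 0 < z \<and> z < 1 \<and> f (y + 1 * k) - f (y + 0 * k) = (1 - 0) * (f' (y + z * k) * k)"
      by (rule MVT2[of 0 1 "\<lambda>s. f (y + s * k)" "\<lambda>s. f' (y + s * k) * k"])
         (auto intro!: derivative_eq_intros DERIV_chain2[OF D])
    then obtain z where z: "0 < z" "z < 1" "f (y + k) - f y = f' (y + z * k) * k" by auto
    have "\<bar>z * k\<bar> \<le> \<bar>k\<bar>" using z by (simp add: abs_mult mult_left_le_one_le)
    then have "dist (f' (y + z * k)) (f' y) < e"
      using yk d(1) by (intro d(2)) (auto simp: dist_real_def)
    then have "\<bar>(f' (y + z * k) - f' y) * k\<bar> \<le> e * \<bar>k\<bar>"
      unfolding abs_mult by (intro mult_right_mono) (auto simp: dist_real_def)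
    then show "\<bar>f (y + k) - f y - f' y * k\<bar> \<le> e * \<bar>k\<bar>"
      using z(3) by (simp add: left_diff_distrib)
  qed
qed

lemma integral_norm_bound_integral_AE:
  fixes f g :: "'a \<Rightarrow> real"
  assumes "integrable M f" "integrable M g" "AE x in M. norm (f x) \<le> g x"
  shows "norm (integral\<^sup>L M f) \<le> integral\<^sup>L M g"
  using integral_norm_bound[of M f] integral_mono_AE[OF integrable_norm[OF assms(1)] assms(2,3)]
  by linarith

text \<open>
  Functions in \<open>W1inf\<close> are bounded by their norm, so the pointwise expansion of \<open>f\<close> holds
  with a uniform remainder and can be integrated against \<open>a\<close>.  Both functionals of the
  problem have this form.
\<close>

lemma has_W1inf_derivative_integral_functional:
  fixes f f' :: "real \<Rightarrow> real"
  assumes \<Omega>: "open \<Omega>" "bounded \<Omega>" and a: "a \<in> Linf \<Omega>" and u: "u \<in> W1inf \<Omega>"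
    and D: "\<And>t. (f has_real_derivative f' t) (at t)" and cont: "continuous_on UNIV f'"
  shows "has_W1inf_derivative \<Omega> (\<lambda>v. LINT x|lebesgue_on \<Omega>. a x * f (v x))
    (\<lambda>h. LINT x|lebesgue_on \<Omega>. a x * f' (u x) * h x) u"
proof -
  let ?M = "lebesgue_on \<Omega>"
  have fin: "\<Omega> \<in> lmeasurable" using \<Omega> by (simp add: lmeasurable_open)
  have contf: "continuous_on UNIV f"
    using D by (meson DERIV_isCont continuous_at_imp_continuous_on)
  have W: "v \<in> Linf \<Omega>" if "v \<in> W1inf \<Omega>" for v using that by (simp add: W1inf_def)
  have af': "(\<lambda>x. a x * f' (u x)) \<in> Linf \<Omega>"
    by (rule Linf_mult[OF a Linf_continuous_compose[OF W[OF u] cont]])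
  have int_L: "integrable ?M (\<lambda>x. a x * f' (u x) * h x)" if "h \<in> W1inf \<Omega>" for h
    using Linf_integrable[OF fin Linf_mult[OF af' W[OF that]]] .
  have int_F: "integrable ?M (\<lambda>x. a x * f (v x))" if "v \<in> W1inf \<Omega>" for v
    by (rule Linf_integrable[OF fin Linf_mult[OF a Linf_continuous_compose[OF W[OF that] contf]]])
  have int_a: "integrable ?M (\<lambda>x. \<bar>a x\<bar>)" using Linf_integrable[OF fin a] by simp
  show ?thesis
    unfolding has_W1inf_derivative_def
  proof (intro conjI ballI allI impI)
    fix v w assume "v \<in> W1inf \<Omega>" "w \<in> W1inf \<Omega>"
    then show "(LINT x|?M. a x * f' (u x) * (v x + w x)) = (LINT x|?M. a x * f' (u x) * v x) + (LINT x|?M. a x * f' (u x) * w x)"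
      using int_L by (simp add: distrib_left)
  next
    fix c v
    show "(LINT x|?M. a x * f' (u x) * (c * v x)) = c * (LINT x|?M. a x * f' (u x) * v x)"
      by (simp add: mult.left_commute[of _ c])
  next
    show "\<exists>B. \<forall>v\<in>W1inf \<Omega>. \<bar>LINT x|?M. a x * f' (u x) * v x\<bar> \<le> B * W1inf_norm \<Omega> v"
    proof (intro exI ballI)
      fix v assume v: "v \<in> W1inf \<Omega>"
      have "norm (LINT x|?M. a x * f' (u x) * v x) \<le> (LINT x|?M. \<bar>a x * f' (u x)\<bar> * W1inf_norm \<Omega> v)"
      proof (rule integral_norm_bound_integral_AE)
        show "integrable ?M (\<lambda>x. a x * f' (u x) * v x)" using v by (rule int_L)
        show "integrable ?M (\<lambda>x. \<bar>a x * f' (u x)\<bar> * W1inf_norm \<Omega> v)"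
          using Linf_integrable[OF fin af'] by simp
        show "AE x in ?M. norm (a x * f' (u x) * v x) \<le> \<bar>a x * f' (u x)\<bar> * W1inf_norm \<Omega> v"
          using W1inf_bound_AE[OF v] by eventually_elim (auto simp: abs_mult intro!: mult_left_mono)
      qed
      then show "\<bar>LINT x|?M. a x * f' (u x) * v x\<bar> \<le> (LINT x|?M. \<bar>a x * f' (u x)\<bar>) * W1inf_norm \<Omega> v"
        by simp
    qed
  next
    fix e :: real assume e: "e > 0"
    define A where "A = (LINT x|?M. \<bar>a x\<bar>)"
    have A: "A \<ge> 0" by (simp add: A_def)
    \<comment> \<open>The remainder is multiplied by \<open>A\<close> on integration; the 1 covers \<open>A = 0\<close>.\<close>
    have e': "e / (A + 1) > 0" using e A by simp
    obtain d where d: "d > 0" "\<And>y k. \<bar>y\<bar> \<le> W1inf_norm \<Omega> u \<Longrightarrow> \<bar>k\<bar> \<le> d \<Longrightarrow>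
        \<bar>f (y + k) - f y - f' y * k\<bar> \<le> e / (A + 1) * \<bar>k\<bar>"
      using C1_uniform_remainder[OF D cont e', of "W1inf_norm \<Omega> u"] by blast
    show "\<exists>\<delta>>0. \<forall>h\<in>W1inf \<Omega>. W1inf_norm \<Omega> h < \<delta> \<longrightarrow>
        \<bar>(LINT x|?M. a x * f (u x + h x)) - (LINT x|?M. a x * f (u x)) - (LINT x|?M. a x * f' (u x) * h x)\<bar>
          \<le> e * W1inf_norm \<Omega> h"
    proof (intro exI[of _ d] conjI ballI impI)
      fix h assume h: "h \<in> W1inf \<Omega>" and small: "W1inf_norm \<Omega> h < d"
      let ?n = "W1inf_norm \<Omega> h"
      have uh: "(\<lambda>x. u x + h x) \<in> W1inf \<Omega>"
        using W1inf_add_scale[OF \<Omega>(1) u h, of 1] by simp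
      have "(LINT x|?M. a x * f (u x + h x)) - (LINT x|?M. a x * f (u x)) - (LINT x|?M. a x * f' (u x) * h x)
          = (LINT x|?M. a x * f (u x + h x) - a x * f (u x) - a x * f' (u x) * h x)"
        using int_F[OF uh] int_F[OF u] int_L[OF h] by simp
      also have "norm \<dots> \<le> (LINT x|?M. \<bar>a x\<bar> * (e / (A + 1) * ?n))"
      proof (rule integral_norm_bound_integral_AE)
        show "integrable ?M (\<lambda>x. a x * f (u x + h x) - a x * f (u x) - a x * f' (u x) * h x)"
          using int_F[OF uh] int_F[OF u] int_L[OF h] by simp
        show "integrable ?M (\<lambda>x. \<bar>a x\<bar> * (e / (A + 1) * ?n))" using int_a by simp
        show "AE x in ?M. norm (a x * f (u x + h x) - a x * f (u x) - a x * f' (u x) * h x) \<le> \<bar>a x\<bar> * (e / (A + 1) * ?n)"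
          using W1inf_bound_AE[OF u] W1inf_bound_AE[OF h]
        proof eventually_elim
          case (elim x)
          have "\<bar>f (u x + h x) - f (u x) - f' (u x) * h x\<bar> \<le> e / (A + 1) * \<bar>h x\<bar>"
            using elim small by (intro d(2)) auto
          also have "\<dots> \<le> e / (A + 1) * ?n"
            using elim e' by (intro mult_left_mono) auto
          finally have "\<bar>a x\<bar> * \<bar>f (u x + h x) - f (u x) - f' (u x) * h x\<bar> \<le> \<bar>a x\<bar> * (e / (A + 1) * ?n)"
            by (intro mult_left_mono) auto
          then show ?case by (simp add: abs_mult[symmetric] right_diff_distrib mult.assoc)
        qed
      qed
      also have "\<dots> = A / (A + 1) * (e * ?n)" using A by (simp add: A_def field_simps)
      also have "\<dots> \<le> e * ?n"
        using A e W1inf_norm_nonneg[of \<Omega> h] by (intro mult_left_le_one_le) auto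
      finally show "\<bar>(LINT x|?M. a x * f (u x + h x)) - (LINT x|?M. a x * f (u x)) - (LINT x|?M. a x * f' (u x) * h x)\<bar>
          \<le> e * ?n" by simp
    qed (fact d(1))
  qed
qed

lemma continuous_on_abs_powr: "q > 0 \<Longrightarrow> continuous_on UNIV (\<lambda>t::real. \<bar>t\<bar> powr q)"
  by (intro continuous_on_powr' continuous_intros) auto

text \<open>
  At the origin the difference quotient is \<open>\<bar>h\<bar> powr q\<close>, which tends to zero as \<open>q > 0\<close>.
\<close>

lemma DERIV_signed_powr:
  assumes q: "q > 0"
  shows "((\<lambda>t::real. \<bar>t\<bar> powr q * t) has_real_derivative (q + 1) * \<bar>t\<bar> powr q) (at t)"
proof (cases t "0::real" rule: linorder_cases)
  case greater
  have "((\<lambda>t. t powr q * t) has_real_derivative (q + 1) * \<bar>t\<bar> powr q) (at t)"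
    using greater by (auto intro!: derivative_eq_intros simp: field_simps powr_diff)
  then show ?thesis
    by (rule has_field_derivative_transform_within_open[of _ _ _ "{0<..}"]) (use greater in auto)
next
  case less
  have "((\<lambda>t. (- t) powr q * t) has_real_derivative (q + 1) * \<bar>t\<bar> powr q) (at t)"
    using less by (auto intro!: derivative_eq_intros simp: field_simps powr_diff)
  then show ?thesis
    by (rule has_field_derivative_transform_within_open[of _ _ _ "{..<0}"]) (use less in auto)
next
  case equal
  have "((\<lambda>h::real. \<bar>h\<bar> powr q) \<longlongrightarrow> 0) (at 0)"
    using continuous_on_abs_powr[OF q] q by (auto simp: continuous_on_eq_continuous_at isCont_def dest!: spec[of _ 0])
  then have "((\<lambda>h. \<bar>h\<bar> powr q * h / h) \<longlongrightarrow> 0) (at 0)"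
    by (rule Lim_transform_eventually) (auto simp: eventually_at_filter)
  then show ?thesis using equal q by (simp add: DERIV_def)
qed

lemma DERIV_abs_powr:
  assumes p: "p > 2"
  shows "((\<lambda>t::real. \<bar>t\<bar> powr p) has_real_derivative p * (\<bar>t\<bar> powr (p - 2) * t)) (at t)"
proof -
  have *: "\<bar>t\<bar> powr p = \<bar>t\<bar> powr (p - 2) * t * t" for t :: real
  proof (cases "t = 0")
    case False
    have "\<bar>t\<bar> powr p = \<bar>t\<bar> powr (p - 2) * \<bar>t\<bar> powr 2" by (simp only: powr_add[symmetric]) simp
    also have "\<bar>t\<bar> powr 2 = t * t" using False by (simp add: power2_eq_square)
    finally show ?thesis by (simp only: mult.assoc)
  qed (use p in simp)
  show ?thesis
    unfolding * using DERIV_mult'[OF DERIV_signed_powr DERIV_ident, of "p - 2" t] p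
    by (simp add: algebra_simps)
qed

section \<open>Variations under one constraint\<close>

text \<open>
  If \<open>J d > 0\<close> for a direction \<open>d\<close> tangent to the constraint, move to
  \<open>t *\<^sub>R (d + s *\<^sub>R e)\<close> with \<open>t\<close> small, where \<open>e\<close> is transversal to the constraint.  At
  \<open>s = \<eta>\<close> and \<open>s = - \<eta>\<close> the constraint functional \<open>c\<close> has opposite signs, so the
  intermediate value theorem yields a correction \<open>s\<close> that satisfies the constraint, and
  \<open>\<eta>\<close> is chosen so small that the correction costs at most half of the gain \<open>J d\<close>.
  Unlike the implicit function theorem, this needs differentiability at one point only, and
  continuity elsewhere.
\<close>

lemma constrained_max_derivative_le:
  fixes j c :: "'e::real_normed_vector \<Rightarrow> real"
  assumes j: "(j has_derivative J) (at 0)" and c: "(c has_derivative C) (at 0)"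
    and cont: "continuous_on UNIV c" and c0: "c 0 = 0"
    and r: "r > 0" and max: "\<And>z. norm z < r \<Longrightarrow> c z = 0 \<Longrightarrow> j z \<le> j 0"
    and d: "C d = 0" and e: "C e > 0"
  shows "J d \<le> 0"
proof (rule ccontr)
  assume "\<not> J d \<le> 0"
  then have Jd: "J d > 0" by simp
  interpret J: bounded_linear J using j by (rule has_derivative_bounded_linear)
  interpret C: bounded_linear C using c by (rule has_derivative_bounded_linear)
  define \<eta> where "\<eta> = J d / (2 * (\<bar>J e\<bar> + 1))"
  have \<eta>: "\<eta> > 0" "\<eta> * \<bar>J e\<bar> \<le> J d / 2"
    using Jd by (auto simp: \<eta>_def field_simps)
  define R where "R = norm d + \<eta> * norm e + 1"
  have R: "R > 0" using \<eta>(1) by (simp add: R_def add_nonneg_pos)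
  have norm_le: "norm (d + s *\<^sub>R e) \<le> R" if "\<bar>s\<bar> \<le> \<eta>" for s
  proof -
    have "norm (d + s *\<^sub>R e) \<le> norm d + \<bar>s\<bar> * norm e" by (metis norm_scaleR norm_triangle_ineq)
    also have "\<dots> \<le> R" using that by (simp add: R_def add_increasing2 mult_right_mono)
    finally show ?thesis .
  qed
  \<comment> \<open>Expansion errors: at most a quarter of the gain for \<open>j\<close>, half of the transversal term for \<open>c\<close>.\<close>
  define \<epsilon> where "\<epsilon> = min (J d / (4 * R)) (\<eta> * C e / (2 * R))"
  have \<epsilon>: "\<epsilon> > 0" using Jd R \<eta> e by (simp add: \<epsilon>_def)
  have \<epsilon>R: "\<epsilon> * R \<le> J d / 4" "\<epsilon> * R \<le> \<eta> * C e / 2"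
  proof -
    have "\<epsilon> * R \<le> J d / (4 * R) * R" "\<epsilon> * R \<le> \<eta> * C e / (2 * R) * R"
      unfolding \<epsilon>_def using R by (intro mult_right_mono; simp)+
    then show "\<epsilon> * R \<le> J d / 4" "\<epsilon> * R \<le> \<eta> * C e / 2" using R by auto
  qed
  obtain r1 where r1: "r1 > 0" "\<And>z. norm z < r1 \<Longrightarrow> \<bar>j z - j 0 - J z\<bar> \<le> \<epsilon> * norm z"
    using j \<epsilon> unfolding has_derivative_at_alt by auto
  obtain r2 where r2: "r2 > 0" "\<And>z. norm z < r2 \<Longrightarrow> \<bar>c z - c 0 - C z\<bar> \<le> \<epsilon> * norm z"
    using c \<epsilon> unfolding has_derivative_at_alt by auto
  define t where "t = min r (min r1 r2) / (2 * R)"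
  have t: "t > 0" using r r1 r2 R by (simp add: t_def)
  have tR: "t * R < r" "t * R < r1" "t * R < r2"
    using r r1(1) r2(1) R by (auto simp: t_def field_simps)
  define z where "z s = t *\<^sub>R (d + s *\<^sub>R e)" for s
  have nz: "norm (z s) \<le> t * R" if "\<bar>s\<bar> \<le> \<eta>" for s
    using norm_le[OF that] t by (simp add: z_def)
  have \<epsilon>z: "\<epsilon> * norm (z s) \<le> t * (\<epsilon> * R)" if "\<bar>s\<bar> \<le> \<eta>" for s
    using mult_left_mono[OF nz[OF that], of \<epsilon>] \<epsilon> by (simp add: mult.left_commute)
  have cz: "\<bar>c (z s) - t * (s * C e)\<bar> \<le> t * (\<eta> * C e / 2)" if "\<bar>s\<bar> \<le> \<eta>" for s
  proof -
    have "\<bar>c (z s) - c 0 - C (z s)\<bar> \<le> \<epsilon> * norm (z s)"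
      using nz[OF that] tR by (intro r2(2)) auto
    also have "\<dots> \<le> t * (\<eta> * C e / 2)"
      using \<epsilon>z[OF that] mult_left_mono[OF \<epsilon>R(2), of t] t by linarith
    finally show ?thesis
      by (simp add: c0 z_def C.scaleR C.add d)
  qed
  have pos: "0 < t * (\<eta> * C e)" using t \<eta> e by simp
  have "c (z (- \<eta>)) \<le> 0" "0 \<le> c (z \<eta>)"
  proof -
    have "\<bar>c (z (- \<eta>)) + t * (\<eta> * C e)\<bar> \<le> t * (\<eta> * C e) / 2" "\<bar>c (z \<eta>) - t * (\<eta> * C e)\<bar> \<le> t * (\<eta> * C e) / 2"
      using cz[of "- \<eta>"] cz[of \<eta>] \<eta>(1) by auto
    then show "c (z (- \<eta>)) \<le> 0" "0 \<le> c (z \<eta>)" using pos by linarith+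
  qed
  moreover have "continuous_on {- \<eta> .. \<eta>} (\<lambda>s. c (z s))"
    unfolding z_def by (intro continuous_on_compose2[OF cont] continuous_intros) auto
  ultimately obtain s where s: "- \<eta> \<le> s" "s \<le> \<eta>" "c (z s) = 0"
    using IVT'[of "\<lambda>s. c (z s)" "- \<eta>" 0 \<eta>] \<eta>(1) by auto
  then have abs_s: "\<bar>s\<bar> \<le> \<eta>" by auto
  have "\<bar>s * J e\<bar> \<le> J d / 2"
    unfolding abs_mult using mult_right_mono[OF abs_s, of "\<bar>J e\<bar>"] \<eta>(2) by simp
  then have "J d / 2 \<le> J d + s * J e" by linarith
  then have "t * (J d / 2) \<le> J (z s)"
    using t by (simp add: z_def J.scaleR J.add)
  moreover have "\<bar>j (z s) - j 0 - J (z s)\<bar> \<le> t * (J d / 4)"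
  proof -
    have "\<bar>j (z s) - j 0 - J (z s)\<bar> \<le> \<epsilon> * norm (z s)"
      using nz[OF abs_s] tR by (intro r1(2)) auto
    also have "\<dots> \<le> t * (J d / 4)"
      using \<epsilon>z[OF abs_s] mult_left_mono[OF \<epsilon>R(1), of t] t by linarith
    finally show ?thesis .
  qed
  moreover have "0 < t * (J d / 4)" using t Jd by simp
  moreover have "t * (J d / 2) = t * (J d / 4) + t * (J d / 4)" by simp
  moreover have "j (z s) \<le> j 0"
    using nz[OF abs_s] tR s by (intro max) auto
  ultimately show False by linarith
qed

lemma constrained_max_derivative_eq_0:
  fixes j c :: "'e::real_normed_vector \<Rightarrow> real"
  assumes j: "(j has_derivative J) (at 0)" and c: "(c has_derivative C) (at 0)"
    and cont: "continuous_on UNIV c" and c0: "c 0 = 0"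
    and r: "r > 0" and max: "\<And>z. norm z < r \<Longrightarrow> c z = 0 \<Longrightarrow> j z \<le> j 0"
    and d: "C d = 0" and e: "C e \<noteq> 0"
  shows "J d = 0"
proof -
  interpret J: bounded_linear J using j by (rule has_derivative_bounded_linear)
  interpret C: bounded_linear C using c by (rule has_derivative_bounded_linear)
  obtain e' where e': "C e' > 0"
    using e C.neg[of e] by (metis linorder_neqE_linordered_idom neg_0_less_iff_less)
  have "J d \<le> 0" "J (- d) \<le> 0"
    using constrained_max_derivative_le[OF j c cont c0 r max _ e', of d]
      constrained_max_derivative_le[OF j c cont c0 r max _ e', of "- d"] d C.neg[of d] by auto
  then show ?thesis using J.neg[of d] by simp
qed

text \<open>
  Restriction to a plane turns derivatives on \<open>W1inf\<close> into derivatives between normed spaces, to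
  which the abstract multiplier rule applies.
\<close>

lemma has_derivative_two_parameter_family:
  assumes \<Omega>: "open \<Omega>" and L: "has_W1inf_derivative \<Omega> F L w"
    and \<phi>: "\<phi> \<in> W1inf \<Omega>" and \<psi>: "\<psi> \<in> W1inf \<Omega>"
  shows "((\<lambda>z::real \<times> real. F (\<lambda>x. w x + (fst z * \<phi> x + snd z * \<psi> x))) has_derivative
    (\<lambda>z. fst z * L \<phi> + snd z * L \<psi>)) (at 0)"
proof -
  let ?h = "\<lambda>z::real \<times> real. \<lambda>x. fst z * \<phi> x + snd z * \<psi> x"
  define N where "N = W1inf_norm \<Omega> \<phi> + W1inf_norm \<Omega> \<psi> + 1"
  have N: "N > 0" using W1inf_norm_nonneg[of \<Omega> \<phi>] W1inf_norm_nonneg[of \<Omega> \<psi>] by (simp add: N_def)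
  have h: "?h z \<in> W1inf \<Omega>" for z
    using W1inf_add_scale[OF \<Omega> W1inf_scale[OF \<Omega> \<phi>] \<psi>] .
  have Lh: "L (?h z) = fst z * L \<phi> + snd z * L \<psi>" for z
    using L W1inf_scale[OF \<Omega> \<phi>] W1inf_scale[OF \<Omega> \<psi>] \<phi> \<psi> by (simp add: has_W1inf_derivative_def)
  have norm_h: "W1inf_norm \<Omega> (?h z) \<le> N * norm z" for z
  proof -
    have "W1inf_norm \<Omega> (?h z) \<le> \<bar>fst z\<bar> * W1inf_norm \<Omega> \<phi> + \<bar>snd z\<bar> * W1inf_norm \<Omega> \<psi>"
      using W1inf_norm_add_scale[OF \<Omega> W1inf_scale[OF \<Omega> \<phi>] \<psi>, of "fst z" "snd z"]
        W1inf_norm_scale[OF \<Omega> \<phi>, of "fst z"] by linarith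
    also have "\<dots> \<le> norm z * W1inf_norm \<Omega> \<phi> + norm z * W1inf_norm \<Omega> \<psi>"
      using norm_fst_le[of "fst z" "snd z"] norm_snd_le[of "snd z" "fst z"]
      by (intro add_mono mult_right_mono) (auto simp: W1inf_norm_nonneg)
    also have "\<dots> \<le> N * norm z"
      by (simp add: N_def algebra_simps)
    finally show ?thesis .
  qed
  show ?thesis
    unfolding has_derivative_at_alt
  proof (intro conjI allI impI)
    show "bounded_linear (\<lambda>z. fst z * L \<phi> + snd z * L \<psi>)"
      by (intro bounded_linear_intros)
    fix e :: real assume e: "e > 0"
    then have "e / N > 0" using N by simp
    then obtain d where d: "d > 0" "\<And>h. h \<in> W1inf \<Omega> \<Longrightarrow> W1inf_norm \<Omega> h < d \<Longrightarrow>
        \<bar>F (\<lambda>x. w x + h x) - F w - L h\<bar> \<le> e / N * W1inf_norm \<Omega> h"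
      using L unfolding has_W1inf_derivative_def by blast
    show "\<exists>d>0. \<forall>y. norm (y - 0) < d \<longrightarrow>
        norm (F (\<lambda>x. w x + ?h y x) - F (\<lambda>x. w x + ?h 0 x) - (fst (y - 0) * L \<phi> + snd (y - 0) * L \<psi>))
        \<le> e * norm (y - 0)"
    proof (intro exI[of _ "d / N"] conjI allI impI)
      show "d / N > 0" using d N by simp
      fix y :: "real \<times> real" assume "norm (y - 0) < d / N"
      then have "W1inf_norm \<Omega> (?h y) < d"
        using norm_h[of y] N by (simp add: field_simps)
      then have "\<bar>F (\<lambda>x. w x + ?h y x) - F w - L (?h y)\<bar> \<le> e / N * W1inf_norm \<Omega> (?h y)"
        using h by (intro d(2))
      also have "\<dots> \<le> e / N * (N * norm y)"
        using norm_h[of y] e N by (intro mult_left_mono) auto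
      finally show "norm (F (\<lambda>x. w x + ?h y x) - F (\<lambda>x. w x + ?h 0 x) - (fst (y - 0) * L \<phi> + snd (y - 0) * L \<psi>))
        \<le> e * norm (y - 0)"
        using N by (simp add: Lh)
    qed
  qed
qed

text \<open>
  Any point of the parameter plane becomes the origin after a shift of the base point, where
  differentiability gives continuity.
\<close>

lemma continuous_two_parameter_family:
  assumes \<Omega>: "open \<Omega>" and L: "\<And>w. w \<in> W1inf \<Omega> \<Longrightarrow> has_W1inf_derivative \<Omega> F (L w) w"
    and u: "u \<in> W1inf \<Omega>" and \<phi>: "\<phi> \<in> W1inf \<Omega>" and \<psi>: "\<psi> \<in> W1inf \<Omega>"
  shows "continuous_on UNIV (\<lambda>z::real \<times> real. F (\<lambda>x. u x + (fst z * \<phi> x + snd z * \<psi> x)))"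
proof (intro continuous_at_imp_continuous_on ballI)
  fix z0 :: "real \<times> real"
  let ?w = "\<lambda>x. u x + fst z0 * \<phi> x + snd z0 * \<psi> x"
  have "?w \<in> W1inf \<Omega>"
    using W1inf_add_scale[OF \<Omega> W1inf_add_scale[OF \<Omega> u \<phi>] \<psi>] .
  from has_derivative_continuous[OF has_derivative_two_parameter_family[OF \<Omega> L[OF this] \<phi> \<psi>]]
  have "isCont (\<lambda>z. F (\<lambda>x. ?w x + (fst z * \<phi> x + snd z * \<psi> x))) (z0 - z0)" by simp
  then have "isCont (\<lambda>z. F (\<lambda>x. ?w x + (fst (z - z0) * \<phi> x + snd (z - z0) * \<psi> x))) z0"
    by (rule isCont_o2[rotated]) (intro continuous_intros)
  then show "isCont (\<lambda>z. F (\<lambda>x. u x + (fst z * \<phi> x + snd z * \<psi> x))) z0"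
    by (simp add: algebra_simps)
qed

text \<open>
  Small perturbations supported in \<open>V\<close> use up at most the slack \<open>1 - \<rho>\<close> there and leave the
  gradient unchanged elsewhere.
\<close>

lemma gradient_bound_stable_under_test_functions:
  assumes \<Omega>: "open \<Omega>" and V: "open V" "V \<subseteq> \<Omega>" and u: "u \<in> W1inf \<Omega>"
    and le1: "Linf_norm \<Omega> (weak_grad \<Omega> u) \<le> 1" and \<rho>: "\<rho> < 1" and inV: "AE x in lebesgue_on V. norm (weak_grad \<Omega> u x) \<le> \<rho>"
    and \<phi>: "\<phi> \<in> Cc_inf V" and \<psi>: "\<psi> \<in> Cc_inf V"
  shows "\<exists>r>0. \<forall>z::real \<times> real. norm z < r \<longrightarrow>
    Linf_norm \<Omega> (weak_grad \<Omega> (\<lambda>x. u x + (fst z * \<phi> x + snd z * \<psi> x))) \<le> 1"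
proof -
  have \<phi>': "\<phi> \<in> Cc_inf \<Omega>" and \<psi>': "\<psi> \<in> Cc_inf \<Omega>"
    using \<phi> \<psi> Cc_inf_mono[OF V(2)] by auto
  obtain B1 B2 where B1: "\<And>x. norm (grad \<phi> x) \<le> B1" and B2: "\<And>x. norm (grad \<psi> x) \<le> B2"
    using Cc_inf_bounded[OF \<phi>] Cc_inf_bounded[OF \<psi>] by metis
  have Bpos: "B1 \<ge> 0" "B2 \<ge> 0" using order_trans[OF norm_ge_zero B1] order_trans[OF norm_ge_zero B2] by auto
  have out: "grad \<phi> x = 0" "grad \<psi> x = 0" if "x \<notin> V" for x
    using Cc_inf_support[OF \<phi>] Cc_inf_support[OF \<psi>] that by (metis subsetD)+
  let ?g = "weak_grad \<Omega> u"
  have "enn2real (Linf_norm \<Omega> ?g) \<le> 1" using le1 by (intro enn2real_leI) auto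
  then have in\<Omega>: "AE x in lebesgue_on \<Omega>. norm (?g x) \<le> 1"
    using Linf_bound_AE[OF weak_grad_Linf[OF \<Omega> u]] by (auto elim!: eventually_mono)
  have inV': "AE x in lebesgue_on \<Omega>. x \<in> V \<longrightarrow> norm (?g x) \<le> \<rho>"
    using inV V \<Omega> by (auto simp: AE_lebesgue_on_iff_negligible elim!: negligible_subset)
  define r where "r = (1 - \<rho>) / (B1 + B2 + 1)"
  have r: "r > 0" using \<rho> Bpos by (simp add: r_def)
  show ?thesis
  proof (intro exI[of _ r] conjI allI impI)
    fix z :: "real \<times> real" assume z: "norm z < r"
    let ?v = "\<lambda>x. u x + (fst z * \<phi> x + snd z * \<psi> x)"
    have v: "?v \<in> W1inf \<Omega>"
      using W1inf_add_scale[OF \<Omega> W1inf_add_scale[OF \<Omega> u Cc_inf_W1inf[OF \<Omega> \<phi>']] Cc_inf_W1inf[OF \<Omega> \<psi>'], of "fst z" "snd z"]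
      by (simp add: add.assoc)
    have "has_weak_gradient \<Omega> ?v (\<lambda>x. ?g x + fst z *\<^sub>R grad \<phi> x + snd z *\<^sub>R grad \<psi> x)"
      using has_weak_gradient_add_scale[OF \<Omega> has_weak_gradient_add_scale[OF \<Omega>
          has_weak_gradient_weak_grad[OF u] has_weak_gradient_Cc_inf[OF \<Omega> \<phi>']]
          has_weak_gradient_Cc_inf[OF \<Omega> \<psi>'], of "fst z" "snd z"]
      by (simp add: add.assoc)
    from weak_grad_AE_eq[OF \<Omega> this]
    have eq: "AE x in lebesgue_on \<Omega>. weak_grad \<Omega> ?v x = ?g x + fst z *\<^sub>R grad \<phi> x + snd z *\<^sub>R grad \<psi> x" .
    have "AE x in lebesgue_on \<Omega>. norm (weak_grad \<Omega> ?v x) \<le> 1"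
      using eq in\<Omega> inV'
    proof eventually_elim
      case (elim x)
      show ?case
      proof (cases "x \<in> V")
        case True
        have "norm (fst z *\<^sub>R grad \<phi> x) \<le> norm z * B1" "norm (snd z *\<^sub>R grad \<psi> x) \<le> norm z * B2"
          using norm_fst_le[of "fst z" "snd z"] norm_snd_le[of "snd z" "fst z"] B1 B2
          by (auto intro!: mult_mono)
        moreover have "norm (?g x + fst z *\<^sub>R grad \<phi> x + snd z *\<^sub>R grad \<psi> x)
            \<le> norm (?g x) + norm (fst z *\<^sub>R grad \<phi> x) + norm (snd z *\<^sub>R grad \<psi> x)"
          by (intro norm_triangle_le add_mono norm_triangle_ineq order_refl)
        moreover have "norm z * B1 + norm z * B2 \<le> 1 - \<rho>"
        proof -
          have "norm z * B1 + norm z * B2 \<le> norm z * (B1 + B2 + 1)" by (simp add: algebra_simps)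
          also have "\<dots> \<le> r * (B1 + B2 + 1)" using z Bpos by (intro mult_right_mono) auto
          also have "\<dots> = 1 - \<rho>" using Bpos by (simp add: r_def)
          finally show ?thesis .
        qed
        ultimately show ?thesis using elim True by simp
      qed (use elim out in simp)
    qed
    then show "Linf_norm \<Omega> (weak_grad \<Omega> ?v) \<le> 1"
      using Linf_norm_le[of "weak_grad \<Omega> ?v" \<Omega> 1] weak_grad_Linf[OF \<Omega> v] by (simp add: Linf_def)
  qed (fact r)
qed

section \<open>Multiplier rule and constancy\<close>

lemma has_W1inf_derivative_J_fun:
  assumes "open \<Omega>" "bounded \<Omega>" "a \<in> Linf \<Omega>" "p > 2" "v \<in> W1inf \<Omega>"
  shows "has_W1inf_derivative \<Omega> (J_fun \<Omega> a p)
    (\<lambda>h. LINT x|lebesgue_on \<Omega>. a x * (p * (\<bar>v x\<bar> powr (p - 2) * v x)) * h x) v"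
proof -
  have "continuous_on UNIV (\<lambda>t::real. p * (\<bar>t\<bar> powr (p - 2) * t))"
    using assms(4) by (intro continuous_intros continuous_on_abs_powr) simp
  from has_W1inf_derivative_integral_functional[OF assms(1,2,3,5) DERIV_abs_powr[OF assms(4)] this]
  show ?thesis by (simp add: J_fun_def[abs_def])
qed

lemma has_W1inf_derivative_C_fun:
  assumes "open \<Omega>" "bounded \<Omega>" "a \<in> Linf \<Omega>" "p > 2" "v \<in> W1inf \<Omega>"
  shows "has_W1inf_derivative \<Omega> (C_fun \<Omega> a p)
    (\<lambda>h. LINT x|lebesgue_on \<Omega>. a x * ((p - 1) * \<bar>v x\<bar> powr (p - 2)) * h x) v"
proof -
  have cont: "continuous_on UNIV (\<lambda>t::real. (p - 1) * \<bar>t\<bar> powr (p - 2))"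
    using assms(4) by (intro continuous_intros continuous_on_abs_powr) simp
  have D: "((\<lambda>t::real. \<bar>t\<bar> powr (p - 2) * t) has_real_derivative (p - 1) * \<bar>t\<bar> powr (p - 2)) (at t)" for t
    using DERIV_signed_powr[of "p - 2" t] assms(4) by simp
  show ?thesis
    using has_W1inf_derivative_integral_functional[OF assms(1,2,3,5) D cont]
    by (simp add: C_fun_def[abs_def] mult.assoc)
qed

text \<open>
  On \<open>V\<close> the gradient constraint is inactive, so near \<open>u\<close> only the constraint
  \<open>C_fun = 0\<close> restricts variations in the plane spanned by \<open>\<phi>\<close> and \<open>\<psi>\<close>.  The symmetric form
  of the conclusion is the Lagrange multiplier rule without division, and includes the
  degenerate case where the derivative of the constraint vanishes on both functions.  The set
  \<open>V\<close> may be disconnected, which is what links the multipliers of different regions.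
\<close>

lemma derivatives_proportional_where_gradient_slack:
  assumes \<Omega>: "open \<Omega>" "bounded \<Omega>" and a: "a \<in> Linf \<Omega>" and p: "p > 2"
    and max: "is_arg_max (J_fun \<Omega> a p) (\<lambda>v. v \<in> K_set \<Omega> a p) u"
    and V: "open V" "V \<subseteq> \<Omega>" and \<rho>: "\<rho> < 1" "AE x in lebesgue_on V. norm (weak_grad \<Omega> u x) \<le> \<rho>"
    and \<phi>: "\<phi> \<in> Cc_inf V" and \<psi>: "\<psi> \<in> Cc_inf V"
  shows "W1inf_derivative \<Omega> (J_fun \<Omega> a p) u \<phi> * W1inf_derivative \<Omega> (C_fun \<Omega> a p) u \<psi>
    = W1inf_derivative \<Omega> (J_fun \<Omega> a p) u \<psi> * W1inf_derivative \<Omega> (C_fun \<Omega> a p) u \<phi>"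
proof -
  let ?J = "J_fun \<Omega> a p" and ?C = "C_fun \<Omega> a p"
  let ?dJ = "W1inf_derivative \<Omega> ?J u" and ?dC = "W1inf_derivative \<Omega> ?C u"
  have u: "u \<in> W1inf \<Omega>" "Linf_norm \<Omega> (weak_grad \<Omega> u) \<le> 1" "?C u = 0"
    using max by (auto simp: is_arg_max_def K_set_def)
  have W: "\<phi> \<in> W1inf \<Omega>" "\<psi> \<in> W1inf \<Omega>"
    using \<phi> \<psi> Cc_inf_mono[OF V(2)] Cc_inf_W1inf[OF \<Omega>(1)] by auto
  note DJ = has_W1inf_derivative_J_fun[OF \<Omega> a p] and DC = has_W1inf_derivative_C_fun[OF \<Omega> a p]
  define v where "v z x = u x + (fst z * \<phi> x + snd z * \<psi> x)" for z :: "real \<times> real" and x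
  have v0: "v 0 = u" by (simp add: v_def fun_eq_iff)
  have j: "((\<lambda>z. ?J (v z)) has_derivative (\<lambda>z. fst z * ?dJ \<phi> + snd z * ?dJ \<psi>)) (at 0)"
    using has_derivative_two_parameter_family[OF \<Omega>(1) DJ[OF u(1)] W]
    by (simp add: v_def[abs_def] W1inf_derivative_eq[OF \<Omega>(1) DJ[OF u(1)]] W)
  have c: "((\<lambda>z. ?C (v z)) has_derivative (\<lambda>z. fst z * ?dC \<phi> + snd z * ?dC \<psi>)) (at 0)"
    using has_derivative_two_parameter_family[OF \<Omega>(1) DC[OF u(1)] W]
    by (simp add: v_def[abs_def] W1inf_derivative_eq[OF \<Omega>(1) DC[OF u(1)]] W)
  have cont: "continuous_on UNIV (\<lambda>z. ?C (v z))"
    unfolding v_def using continuous_two_parameter_family[OF \<Omega>(1) DC u(1) W] .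
  obtain r where r: "r > 0" "\<And>z. norm z < r \<Longrightarrow> Linf_norm \<Omega> (weak_grad \<Omega> (v z)) \<le> 1"
    using gradient_bound_stable_under_test_functions[OF \<Omega>(1) V u(1,2) \<rho> \<phi> \<psi>]
    unfolding v_def[abs_def] by blast
  have local_max: "?J (v z) \<le> ?J (v 0)" if "norm z < r" "?C (v z) = 0" for z
  proof -
    have "v z \<in> W1inf \<Omega>"
      unfolding v_def[abs_def] using W1inf_add_scale[OF \<Omega>(1) W1inf_add_scale[OF \<Omega>(1) u(1) W(1)] W(2)]
      by (simp add: add.assoc)
    then have "v z \<in> K_set \<Omega> a p" using r(2)[OF that(1)] that(2) by (simp add: K_set_def)
    then show ?thesis using max by (auto simp: is_arg_max_def v0 not_less)
  qed
  show ?thesis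
  proof (cases "?dC \<phi> = 0 \<and> ?dC \<psi> = 0")
    case False
    then obtain e :: "real \<times> real" where e: "fst e * ?dC \<phi> + snd e * ?dC \<psi> \<noteq> 0"
      by (metis add.commute add.right_neutral fst_conv mult_1 mult_zero_left snd_conv)
    \<comment> \<open>The vector \<open>(?dC \<psi>, - ?dC \<phi>)\<close> spans the kernel of the linearized constraint.\<close>
    have "fst (?dC \<psi>, - ?dC \<phi>) * ?dJ \<phi> + snd (?dC \<psi>, - ?dC \<phi>) * ?dJ \<psi> = 0"
    proof (rule constrained_max_derivative_eq_0[OF j c cont _ r(1) _ _ e])
      show "?C (v 0) = 0" using u(3) by (simp add: v0)
      show "fst (?dC \<psi>, - ?dC \<phi>) * ?dC \<phi> + snd (?dC \<psi>, - ?dC \<phi>) * ?dC \<psi> = 0" by simp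
    qed (fact local_max)
    then show ?thesis by (simp add: mult.commute)
  qed simp
qed

lemma integrable_imp_locally_integrable:
  fixes f :: "'a::euclidean_space \<Rightarrow> real"
  assumes \<Omega>: "\<Omega> \<in> sets lebesgue" and f: "integrable (lebesgue_on \<Omega>) f" and U: "U \<subseteq> \<Omega>"
  shows "locally_integrable U f"
  unfolding locally_integrable_def
proof (intro allI impI)
  fix K assume K: "compact K \<and> K \<subseteq> U"
  then have M: "K \<in> sets lebesgue" by (simp add: compact_imp_closed)
  have "integrable lebesgue (\<lambda>x. indicator \<Omega> x *\<^sub>R f x)"
    using f \<Omega> by (subst (asm) integrable_restrict_space) auto
  from integrable_mult_indicator[OF M this]
  have "integrable lebesgue (\<lambda>x. indicator K x *\<^sub>R indicator \<Omega> x *\<^sub>R f x)" .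
  moreover have "(\<lambda>x. indicator K x *\<^sub>R indicator \<Omega> x *\<^sub>R f x) = (\<lambda>x. indicator K x *\<^sub>R f x)"
    using K U by (auto simp: indicator_def fun_eq_iff)
  ultimately show "integrable (lebesgue_on K) f"
    using M by (subst integrable_restrict_space) auto
qed

text \<open>
  The weak equation holds almost everywhere by the fundamental lemma, and \<open>a\<close> can be divided
  out; by continuity the exceptional set is open, and an open null set is empty.
\<close>

lemma pointwise_equation_if_weak_equation:
  fixes g :: "real \<Rightarrow> real"
  assumes \<Omega>: "open \<Omega>" "bounded \<Omega>" and a: "a \<in> Linf \<Omega>" and u: "u \<in> W1inf \<Omega>"
    and g: "continuous_on UNIV g" and U: "open U" "U \<subseteq> \<Omega>" and nz: "AE x in lebesgue_on U. a x \<noteq> 0"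
    and weak: "\<And>\<phi>. \<phi> \<in> Cc_inf U \<Longrightarrow> (LINT x|lebesgue_on \<Omega>. a x * g (u x) * \<phi> x) = 0"
    and x: "x \<in> U"
  shows "g (u x) = 0"
proof -
  have uL: "u \<in> Linf \<Omega>" and cu: "continuous_on \<Omega> u" using u by (auto simp: W1inf_def)
  have fin: "\<Omega> \<in> lmeasurable" using \<Omega> by (simp add: lmeasurable_open)
  have "AE x in lebesgue_on U. a x * g (u x) = 0"
  proof (rule fundamental_lemma_calculus_of_variations[OF U(1)])
    show "locally_integrable U (\<lambda>x. a x * g (u x))"
      using integrable_imp_locally_integrable[OF _ Linf_integrable[OF fin Linf_mult[OF a Linf_continuous_compose[OF uL g]]] U(2)]
        \<Omega> by simp
    fix \<phi> assume \<phi>: "\<phi> \<in> Cc_inf U"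
    have out: "\<phi> x = 0" if "x \<notin> U" for x
      using Cc_inf_support[OF \<phi>] that by (metis subsetD)
    have "(LINT x|lebesgue_on U. a x * g (u x) * \<phi> x)
        = (LINT x|lebesgue_on \<Omega>. (if x \<in> U then a x * g (u x) * \<phi> x else 0))"
      using U \<Omega> by (intro integral_restrict[symmetric]) auto
    also have "\<dots> = (LINT x|lebesgue_on \<Omega>. a x * g (u x) * \<phi> x)"
      using out by (intro Bochner_Integration.integral_cong) auto
    finally show "(LINT x|lebesgue_on U. a x * g (u x) * \<phi> x) = 0"
      using weak[OF \<phi>] by simp
  qed
  then have "AE x in lebesgue_on U. g (u x) = 0"
    using nz by eventually_elim simp
  then have neg: "negligible {x \<in> U. g (u x) \<noteq> 0}"
    using U by (simp add: AE_lebesgue_on_iff_negligible)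
  have "continuous_on U (\<lambda>x. g (u x))"
    using U by (intro continuous_on_compose2[OF g] continuous_on_subset[OF cu]) auto
  then have "open (U \<inter> (\<lambda>x. g (u x)) -` (- {0}))"
    using U(1) by (intro continuous_open_preimage) auto
  moreover have "U \<inter> (\<lambda>x. g (u x)) -` (- {0}) = {x \<in> U. g (u x) \<noteq> 0}" by auto
  ultimately have "{x \<in> U. g (u x) \<noteq> 0} = {}"
    using neg open_not_negligible by metis
  then show ?thesis using x by blast
qed

theorem proposition4p7:
  fixes \<Omega> :: "(real ^ 'n) set" and a u :: "real ^ 'n \<Rightarrow> real" and p :: real
  assumes "CARD('n) \<ge> 2"
    and "open \<Omega>" and "\<Omega> \<noteq> {}" and "bounded \<Omega>" and "convex \<Omega>" and "C2_boundary \<Omega>"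
    and "p > 2"
    and "a \<in> Linf \<Omega>" and "(LINT x|lebesgue_on \<Omega>. a x) < 0"
    and "interior {x \<in> \<Omega>. a x > 0} \<noteq> {}"
    and "is_arg_max (J_fun \<Omega> a p) (\<lambda>v. v \<in> K_set \<Omega> a p) u"
  shows "\<exists>\<mu>::real. \<forall>U. open U \<and> connected U \<and> U \<subseteq> \<Omega> \<and>
      Linf_norm U (weak_grad \<Omega> u) < 1 \<and> (AE x in lebesgue_on U. a x \<noteq> 0) \<longrightarrow>
        u constant_on U \<and>
        ((\<forall>x\<in>U. u x = 0) \<or> (\<forall>x\<in>U. u x = (p - 1) / p * \<mu>)) \<and>
        (\<not> (\<forall>x\<in>U. u x = 0) \<longrightarrow>
          (\<forall>\<nu>::real. (\<forall>\<phi>\<in>Cc_inf U. W1inf_derivative \<Omega> (J_fun \<Omega> a p) u \<phi>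
              = \<nu> * W1inf_derivative \<Omega> (C_fun \<Omega> a p) u \<phi>) \<longleftrightarrow> \<nu> = \<mu>))"
proof -
  note \<Omega> = \<open>open \<Omega>\<close> \<open>bounded \<Omega>\<close> and p = \<open>p > 2\<close> and a = \<open>a \<in> Linf \<Omega>\<close>
  note maximal = \<open>is_arg_max (J_fun \<Omega> a p) (\<lambda>v. v \<in> K_set \<Omega> a p) u\<close>
  let ?dJ = "W1inf_derivative \<Omega> (J_fun \<Omega> a p) u" and ?dC = "W1inf_derivative \<Omega> (C_fun \<Omega> a p) u"
  let ?g = "\<lambda>t::real. (p - 1) * \<bar>t\<bar> powr (p - 2)" and ?f = "\<lambda>t::real. p * (\<bar>t\<bar> powr (p - 2) * t)"
  have u: "u \<in> W1inf \<Omega>" using maximal by (auto simp: is_arg_max_def K_set_def)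
  have cont_g: "continuous_on UNIV ?g" and cont_f: "continuous_on UNIV ?f"
    using p by (auto intro!: continuous_intros continuous_on_abs_powr)
  have dJ: "?dJ h = (LINT x|lebesgue_on \<Omega>. a x * ?f (u x) * h x)"
    and dC: "?dC h = (LINT x|lebesgue_on \<Omega>. a x * ?g (u x) * h x)" if "h \<in> W1inf \<Omega>" for h
    using W1inf_derivative_eq[OF \<Omega>(1) has_W1inf_derivative_J_fun[OF \<Omega> a p u] that]
      W1inf_derivative_eq[OF \<Omega>(1) has_W1inf_derivative_C_fun[OF \<Omega> a p u] that] by simp_all
  define good where "good U \<longleftrightarrow> open U \<and> connected U \<and> U \<subseteq> \<Omega> \<and>
      Linf_norm U (weak_grad \<Omega> u) < 1 \<and> (AE x in lebesgue_on U. a x \<noteq> 0)" for U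
  have test: "\<phi> \<in> W1inf \<Omega>" if "good U" "\<phi> \<in> Cc_inf U" for U \<phi>
    using that Cc_inf_mono[of U \<Omega>] Cc_inf_W1inf[OF \<Omega>(1)] by (auto simp: good_def)
  have slack: "\<exists>\<rho><1. AE x in lebesgue_on U. norm (weak_grad \<Omega> u x) \<le> \<rho>" if "good U" for U
  proof (intro exI conjI)
    have less: "Linf_norm U (weak_grad \<Omega> u) < 1" using that by (simp add: good_def)
    then have "Linf_norm U (weak_grad \<Omega> u) < top" by (rule less_trans) simp
    then show "enn2real (Linf_norm U (weak_grad \<Omega> u)) < 1" 
      "AE x in lebesgue_on U. norm (weak_grad \<Omega> u x) \<le> enn2real (Linf_norm U (weak_grad \<Omega> u))"
      using less by (auto intro: Linf_norm_bound_AE)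
  qed
  \<comment> \<open>If the derivative of the constraint vanished on all test functions in \<open>U\<close>, then so would \<open>\<bar>u\<bar> powr (p - 2)\<close>.\<close>
  have nondegenerate: "\<exists>\<phi>\<in>Cc_inf U. ?dC \<phi> \<noteq> 0" if U: "good U" and nz: "\<not> (\<forall>x\<in>U. u x = 0)" for U
  proof (rule ccontr)
    assume "\<not> ?thesis"
    then have weak: "(LINT x|lebesgue_on \<Omega>. a x * ?g (u x) * \<phi> x) = 0" if "\<phi> \<in> Cc_inf U" for \<phi>
      using that dC[OF test[OF U that]] by auto
    have "?g (u x) = 0" if "x \<in> U" for x
      by (rule pointwise_equation_if_weak_equation[OF \<Omega> a u cont_g _ _ _ weak that])
         (use U in \<open>auto simp: good_def\<close>)
    with nz p show False by auto
  qed
  obtain \<mu> where \<mu>: "\<And>U \<phi>. good U \<Longrightarrow> \<not> (\<forall>x\<in>U. u x = 0) \<Longrightarrow> \<phi> \<in> Cc_inf U \<Longrightarrow> ?dJ \<phi> = \<mu> * ?dC \<phi>"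
  proof (cases "\<exists>U. good U \<and> \<not> (\<forall>x\<in>U. u x = 0)")
    case True
    then obtain U0 \<phi>0 where U0: "good U0" and \<phi>0: "\<phi>0 \<in> Cc_inf U0" "?dC \<phi>0 \<noteq> 0"
      using nondegenerate by metis
    show thesis
    proof (rule that[of "?dJ \<phi>0 / ?dC \<phi>0"])
      fix U \<phi> assume U: "good U" and \<phi>: "\<phi> \<in> Cc_inf U"
      obtain \<rho>0 \<rho> where \<rho>: "\<rho>0 < 1" "AE x in lebesgue_on U0. norm (weak_grad \<Omega> u x) \<le> \<rho>0"
          "\<rho> < 1" "AE x in lebesgue_on U. norm (weak_grad \<Omega> u x) \<le> \<rho>"
        using slack[OF U0] slack[OF U] by blast
      \<comment> \<open>Varying on both regions at once compares \<open>\<phi>\<close> with the fixed \<open>\<phi>0\<close>, so one ratio serves all regions.\<close>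
      let ?V = "U0 \<union> U"
      have V: "open ?V" "?V \<subseteq> \<Omega>" "open U0" "open U" using U0 U by (auto simp: good_def)
      have "negligible ({x \<in> U0. \<not> norm (weak_grad \<Omega> u x) \<le> \<rho>0} \<union> {x \<in> U. \<not> norm (weak_grad \<Omega> u x) \<le> \<rho>})"
        using \<rho> V by (simp add: AE_lebesgue_on_iff_negligible)
      then have "negligible {x \<in> ?V. \<not> norm (weak_grad \<Omega> u x) \<le> max \<rho>0 \<rho>}"
        by (rule negligible_subset) auto
      then have "AE x in lebesgue_on ?V. norm (weak_grad \<Omega> u x) \<le> max \<rho>0 \<rho>"
        using V(1) by (subst AE_lebesgue_on_iff_negligible) auto
      then have "?dJ \<phi> * ?dC \<phi>0 = ?dJ \<phi>0 * ?dC \<phi>"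
        using \<rho> V \<phi> \<phi>0 Cc_inf_mono[of U0 ?V] Cc_inf_mono[of U ?V]
        by (intro derivatives_proportional_where_gradient_slack[OF \<Omega> a p maximal V(1,2), of "max \<rho>0 \<rho>"]) auto
      then show "?dJ \<phi> = ?dJ \<phi>0 / ?dC \<phi>0 * ?dC \<phi>"
        using \<phi>0 by (simp add: field_simps)
    qed
  qed (use that in blast)
  have two_values: "u x = 0 \<or> u x = (p - 1) / p * \<mu>" if U: "good U" and nz: "\<not> (\<forall>x\<in>U. u x = 0)" and x: "x \<in> U" for U x
  proof -
    let ?h = "\<lambda>t. ?f t - \<mu> * ?g t"
    have cont_h: "continuous_on UNIV ?h" by (rule continuous_on_diff[OF cont_f continuous_on_mult_left[OF cont_g]])
    have weak: "(LINT x|lebesgue_on \<Omega>. a x * ?h (u x) * \<phi> x) = 0" if \<phi>: "\<phi> \<in> Cc_inf U" for \<phi>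
    proof -
      have fin: "\<Omega> \<in> lmeasurable" using \<Omega> by (simp add: lmeasurable_open)
      have L: "u \<in> Linf \<Omega>" "\<phi> \<in> Linf \<Omega>" using u test[OF U \<phi>] by (auto simp: W1inf_def)
      have int: "integrable (lebesgue_on \<Omega>) (\<lambda>x. a x * ?f (u x) * \<phi> x)"
        "integrable (lebesgue_on \<Omega>) (\<lambda>x. a x * ?g (u x) * \<phi> x)"
        using Linf_integrable[OF fin Linf_mult[OF Linf_mult[OF a Linf_continuous_compose[OF L(1) cont_f]] L(2)]]
          Linf_integrable[OF fin Linf_mult[OF Linf_mult[OF a Linf_continuous_compose[OF L(1) cont_g]] L(2)]] .
      have "(LINT x|lebesgue_on \<Omega>. a x * ?h (u x) * \<phi> x)
          = (LINT x|lebesgue_on \<Omega>. a x * ?f (u x) * \<phi> x - \<mu> * (a x * ?g (u x) * \<phi> x))"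
        by (intro Bochner_Integration.integral_cong) (auto simp: algebra_simps)
      also have "\<dots> = ?dJ \<phi> - \<mu> * ?dC \<phi>"
        using int dJ[OF test[OF U \<phi>]] dC[OF test[OF U \<phi>]] by simp
      finally show ?thesis using \<mu>[OF U nz \<phi>] by simp
    qed
    have "?h (u x) = 0"
      by (rule pointwise_equation_if_weak_equation[OF \<Omega> a u cont_h _ _ _ weak x])
         (use U in \<open>auto simp: good_def\<close>)
    then have "\<bar>u x\<bar> powr (p - 2) * (p * u x - \<mu> * (p - 1)) = 0" by (simp add: algebra_simps)
    then have "u x = 0 \<or> p * u x = \<mu> * (p - 1)" by auto
    then show ?thesis using p by (auto simp: field_simps)
  qed
  show ?thesis
  proof (intro exI[of _ \<mu>] allI impI)
    fix U assume "open U \<and> connected U \<and> U \<subseteq> \<Omega> \<and> Linf_norm U (weak_grad \<Omega> u) < 1 \<and> (AE x in lebesgue_on U. a x \<noteq> 0)"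
    then have U: "good U" by (simp add: good_def)
    show "u constant_on U \<and> ((\<forall>x\<in>U. u x = 0) \<or> (\<forall>x\<in>U. u x = (p - 1) / p * \<mu>)) \<and>
        (\<not> (\<forall>x\<in>U. u x = 0) \<longrightarrow> (\<forall>\<nu>. (\<forall>\<phi>\<in>Cc_inf U. ?dJ \<phi> = \<nu> * ?dC \<phi>) \<longleftrightarrow> \<nu> = \<mu>))"
    proof (cases "\<forall>x\<in>U. u x = 0")
      case True
      then show ?thesis by (auto simp: constant_on_def)
    next
      case False
      have "u ` U \<subseteq> {0, (p - 1) / p * \<mu>}" using two_values[OF U False] by auto
      then have "finite (u ` U)" by (rule finite_subset) simp
      moreover have "continuous_on U u" "connected U"
        using u U by (auto simp: W1inf_def good_def intro: continuous_on_subset)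
      ultimately have const: "u constant_on U"
        using continuous_finite_range_constant by blast
      then have "\<forall>x\<in>U. u x = (p - 1) / p * \<mu>"
        using False two_values[OF U False] by (metis constant_on_def)
      moreover have "(\<forall>\<phi>\<in>Cc_inf U. ?dJ \<phi> = \<nu> * ?dC \<phi>) \<longleftrightarrow> \<nu> = \<mu>" for \<nu>
        using \<mu>[OF U False] nondegenerate[OF U False] by auto
      ultimately show ?thesis using const False by blast
    qed
  qed
qed

end
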